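(* Let $\mathcal{A}$ be a Banach algebra such that $\mathrm{rad}(\mathcal{A})=\mathrm{rann}(\mathcal{A})$ and $\mathcal{A}/\mathrm{rad}(\mathcal{A})$ is commutative, and suppose $\mathcal{A}$ has a right identity. Then the algebra $\mathfrak{C}(\mathcal{A})$ of all centralizing generalized derivations of $\mathcal{A}$ (with composition as product) is isomorphic to $\mathcal{A}/\mathrm{rad}(\mathcal{A})$.
   Context: $\mathrm{rad}(\mathcal{A})$ is the Jacobson radical and $\mathrm{rann}(\mathcal{A})=\{c\in\mathcal{A}: ac=0\ \forall a\in\mathcal{A}\}$. A derivation is a linear map $d$ with $d(ab)=d(a)b+ad(b)$; a generalized derivation is a linear $\delta$ for which there is a derivation $d$ with $\delta(ab)=a\delta(b)+d(a)b$. It is centralizing if $[\delta(a),a]\in Z(\mathcal{A})$ for all $a$, where $Z(\mathcal{A})$ is the center and $[x,y]=xy-yx$. $\mathfrak{C}(\mathcal{A})$ is regarded as a subalgebra of the algebra of bounded linear operators on $\mathcal{A}$. *)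

theory Defs
  imports "HOL-Analysis.Analysis"
begin

text \<open>A complex Banach algebra: a real Banach algebra (type class
  real_normed_algebra + banach; no unit is assumed) together with a complex
  scalar multiplication sm extending scaleR and compatible with the
  ring structure and the norm.\<close>

definition complex_banach_algebra :: "(complex \<Rightarrow> 'a::{real_normed_algebra,banach} \<Rightarrow> 'a) \<Rightarrow> bool" where
  "complex_banach_algebra sm \<longleftrightarrow>
     (\<forall>r x. sm (complex_of_real r) x = scaleR r x) \<and>
     (\<forall>c x y. sm c (x + y) = sm c x + sm c y) \<and>
     (\<forall>c d x. sm (c + d) x = sm c x + sm d x) \<and>
     (\<forall>c d x. sm (c * d) x = sm c (sm d x)) \<and>
     (\<forall>c x y. sm c (x * y) = sm c x * y) \<and>
     (\<forall>c x y. sm c (x * y) = x * sm c y) \<and>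
     (\<forall>c x. norm (sm c x) = cmod c * norm x)"

definition clinear_map :: "(complex \<Rightarrow> 'a::{real_normed_algebra,banach} \<Rightarrow> 'a) \<Rightarrow> ('a \<Rightarrow> 'a) \<Rightarrow> bool" where
  "clinear_map sm f \<longleftrightarrow> (\<forall>x y. f (x + y) = f x + f y) \<and> (\<forall>c x. f (sm c x) = sm c (f x))"

definition quasi_invertible :: "'a::ring \<Rightarrow> bool" where
  "quasi_invertible x \<longleftrightarrow> (\<exists>y. x + y - x * y = 0 \<and> y + x - y * x = 0)"

text \<open>Jacobson radical (valid also for non-unital algebras).\<close>
definition jrad :: "'a::ring set" where
  "jrad = {x. \<forall>a. quasi_invertible (a * x)}"

definition rann :: "'a::ring set" where
  "rann = {c. \<forall>a. a * c = 0}"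

definition center :: "'a::ring set" where
  "center = {z. \<forall>a. z * a = a * z}"

definition derivation :: "(complex \<Rightarrow> 'a::{real_normed_algebra,banach} \<Rightarrow> 'a) \<Rightarrow> ('a \<Rightarrow> 'a) \<Rightarrow> bool" where
  "derivation sm d \<longleftrightarrow> clinear_map sm d \<and> (\<forall>a b. d (a * b) = d a * b + a * d b)"

definition generalized_derivation :: "(complex \<Rightarrow> 'a::{real_normed_algebra,banach} \<Rightarrow> 'a) \<Rightarrow> ('a \<Rightarrow> 'a) \<Rightarrow> bool" where
  "generalized_derivation sm \<delta> \<longleftrightarrow> clinear_map sm \<delta> \<and>
     (\<exists>d. derivation sm d \<and> (\<forall>a b. \<delta> (a * b) = a * \<delta> b + d a * b))"

definition centralizing :: "('a::ring \<Rightarrow> 'a) \<Rightarrow> bool" where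
  "centralizing \<delta> \<longleftrightarrow> (\<forall>a. \<delta> a * a - a * \<delta> a \<in> center)"

definition CGD :: "(complex \<Rightarrow> 'a::{real_normed_algebra,banach} \<Rightarrow> 'a) \<Rightarrow> ('a \<Rightarrow> 'a) set" where
  "CGD sm = {\<delta>. generalized_derivation sm \<delta> \<and> centralizing \<delta>}"

definition rcoset :: "'a::ring \<Rightarrow> 'a set" where
  "rcoset x = {x + r | r. r \<in> jrad}"

text \<open>C(A) is a complex algebra under pointwise operations and composition,
  and it is isomorphic (as complex algebra) to A / rad(A) with the operations
  (x+R)+(y+R) = (x+y)+R, c(x+R) = cx+R, (x+R)(y+R) = xy+R.\<close>
definition CGD_iso_quotient :: "(complex \<Rightarrow> 'a::{real_normed_algebra,banach} \<Rightarrow> 'a) \<Rightarrow> bool" where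
  "CGD_iso_quotient sm \<longleftrightarrow>
     (\<forall>\<delta>\<in>CGD sm. \<forall>\<gamma>\<in>CGD sm. \<forall>c.
        (\<lambda>z. \<delta> z + \<gamma> z) \<in> CGD sm \<and> (\<lambda>z. sm c (\<delta> z)) \<in> CGD sm \<and> \<delta> \<circ> \<gamma> \<in> CGD sm) \<and>
     (\<exists>\<Phi>. bij_betw \<Phi> (CGD sm) (range rcoset) \<and>
        (\<forall>\<delta>\<in>CGD sm. \<forall>\<gamma>\<in>CGD sm. \<forall>x y c. \<Phi> \<delta> = rcoset x \<longrightarrow> \<Phi> \<gamma> = rcoset y \<longrightarrow>
            \<Phi> (\<lambda>z. \<delta> z + \<gamma> z) = rcoset (x + y) \<and>
            \<Phi> (\<lambda>z. sm c (\<delta> z)) = rcoset (sm c x) \<and>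
            \<Phi> (\<delta> \<circ> \<gamma>) = rcoset (x * y)))"

end

theory Submission
  imports Defs
begin

text \<open>
  Let \<open>e\<close> be a right identity and \<open>R\<close> the radical. A generalized derivation has the form
  \<open>\<delta> a = a \<cdot> \<delta> e + d a\<close>. Commutators lie in \<open>R\<close>, which meets the center trivially, so a centralizing
  \<open>\<delta>\<close> satisfies \<open>\<delta> a \<cdot> a = a \<cdot> \<delta> a\<close>; this forces \<open>d a = e \<cdot> d a\<close>. Hence \<open>d\<close> is determined by the
  derivation it induces on the commutative semisimple algebra \<open>A / R\<close>, which vanishes by Johnson's
  theorem. So the centralizing generalized derivations are the right multiplications, and right
  multiplication by \<open>x\<close> depends exactly on \<open>x + R\<close>.

  Johnson's theorem: only finitely many characters \<open>\<phi>\<close> have \<open>\<phi> \<circ> d\<close> discontinuous, by a gliding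
  hump. A limit \<open>y\<close> of \<open>d x\<^sub>n\<close> with \<open>x\<^sub>n \<rightarrow> 0\<close> is killed by all the other characters; if one of the
  exceptional \<open>\<phi>\<close> did not kill \<open>y\<close>, it would be isolated in the character space and then
  \<open>\<phi> \<circ> d = 0\<close>. By semisimplicity \<open>y = 0\<close>, so \<open>d\<close> is continuous by the closed graph theorem. If
  \<open>\<phi> a = 0\<close>, then \<open>\<phi> (d\<^sup>n (a\<^sup>n)) = n! (\<phi> (d a))\<^sup>n\<close>, and the left-hand side grows at most
  geometrically, whence \<open>\<phi> (d a) = 0\<close>.
\<close>

section \<open>The closed graph theorem\<close>

text \<open>By linearity the closed graph condition is stated at 0 only. Baire's theorem makes some
  sublevel set of \<open>norm (f x)\<close> dense in a ball; successive approximation then expands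
  every small vector in a series whose images converge absolutely.\<close>

lemma closed_graph_bounded_linear:
  fixes f :: "'a::banach \<Rightarrow> 'b::banach"
  assumes lin: "linear f"
    and closed: "\<And>X y. X \<longlonglongrightarrow> 0 \<Longrightarrow> (\<lambda>n. f (X n)) \<longlonglongrightarrow> y \<Longrightarrow> y = 0"
  shows "bounded_linear f"
proof -
  interpret linear f by (fact lin)
  define V where "V n = closure {x. norm (f x) \<le> real n}" for n
  have "\<exists>n. interior (V n) \<noteq> {}"
  proof (rule ccontr)
    assume "\<not> ?thesis"
    then have "Met_TC.mtopology interior_of \<Union>(range V) = {}"
      by (intro Met_TC.metric_Baire_category_alt) (auto simp: V_def complete_UNIV)
    moreover have "x \<in> V (nat \<lceil>norm (f x)\<rceil>)" for x
      unfolding V_def by (rule closure_subset[THEN subsetD]) (simp add: of_nat_ceiling)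
    then have "\<Union>(range V) = UNIV" by blast
    ultimately show False by simp
  qed
  then obtain n z where "z \<in> interior (V n)" by blast
  then obtain \<epsilon> where \<epsilon>: "\<epsilon> > 0" "ball z \<epsilon> \<subseteq> V n"
    by (meson mem_interior)
  \<comment> \<open>Differences of two points of the sublevel set have images of norm at most
    \<open>2 * n\<close>; the extra 1 keeps \<open>K\<close> positive.\<close>
  define K where "K = 2 * real n + 1"
  have K: "K > 0" by (simp add: K_def)
  have approx: "\<exists>u. norm (f u) \<le> K \<and> norm (x - u) < \<eta>" if "norm x < \<epsilon>" "\<eta> > 0" for x \<eta>
  proof -
    have "z + x \<in> V n" "z \<in> V n" using that \<epsilon> by (auto simp: dist_norm)
    then obtain a b where a: "norm (f a) \<le> n" "dist a (z + x) < \<eta>/2"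
      and b: "norm (f b) \<le> n" "dist b z < \<eta>/2"
      using \<open>\<eta> > 0\<close> unfolding V_def closure_approachable by (metis half_gt_zero mem_Collect_eq)
    have "norm (f (a - b)) \<le> K"
      using norm_triangle_ineq4[of "f a" "f b"] a b by (simp add: diff K_def)
    moreover have "norm (x - (a - b)) \<le> norm (z + x - a) + norm (b - z)"
      using norm_triangle_ineq[of "z + x - a" "b - z"] by (simp add: algebra_simps)
    ultimately show ?thesis
      using a b by (intro exI[of _ "a - b"]) (auto simp: dist_norm norm_minus_commute)
  qed
  have scaled: "\<exists>u. norm (f u) \<le> K * (1/2)^k \<and> norm (x - u) < \<epsilon> * (1/2)^Suc k"
    if "norm x < \<epsilon> * (1/2)^k" for x k
  proof -
    have "norm (2^k *\<^sub>R x) < \<epsilon>" using that by (simp add: field_simps)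
    then obtain u where u: "norm (f u) \<le> K" "norm (2^k *\<^sub>R x - u) < \<epsilon>/2"
      using approx[of "2^k *\<^sub>R x" "\<epsilon>/2"] \<epsilon> by auto
    have "x - (1/2)^k *\<^sub>R u = (1/2)^k *\<^sub>R (2^k *\<^sub>R x - u)"
      by (simp add: algebra_simps power_one_over)
    then have "norm (x - (1/2)^k *\<^sub>R u) = (1/2)^k * norm (2^k *\<^sub>R x - u)"
      by simp
    also have "\<dots> < \<epsilon> * (1/2)^Suc k"
      using u by (simp add: power_one_over field_simps)
    finally have "norm (x - (1/2)^k *\<^sub>R u) < \<epsilon> * (1/2)^Suc k" .
    then show ?thesis
      using u by (intro exI[of _ "(1/2)^k *\<^sub>R u"]) (auto simp: scale field_simps)
  qed
  have bound: "norm (f x) \<le> 2 * K" if x: "norm x < \<epsilon>" for x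
  proof -
    \<comment> \<open>\<open>X k\<close> is the remainder of \<open>x\<close> after \<open>k\<close>
      approximations, so the approximants are \<open>X k - X (Suc k)\<close> and their images
      telescope.\<close>
    obtain X where X0: "X 0 = x" and X: "\<And>k. norm (X k) < \<epsilon> * (1/2)^k"
      and step: "\<And>k. norm (f (X k - X (Suc k))) \<le> K * (1/2)^k"
    proof -
      have "\<exists>X. \<forall>k. (norm (X k) < \<epsilon> * (1/2)^k \<and> (k = 0 \<longrightarrow> X k = x))
              \<and> norm (f (X k - X (Suc k))) \<le> K * (1/2)^k"
      proof (rule dependent_nat_choice)
        show "\<exists>y. norm y < \<epsilon> * (1/2)^0 \<and> (0 = (0::nat) \<longrightarrow> y = x)" using x by auto
      next
        fix y k assume "norm y < \<epsilon> * (1/2)^k \<and> (k = 0 \<longrightarrow> y = x)"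
        then obtain u where "norm (f u) \<le> K * (1/2)^k \<and> norm (y - u) < \<epsilon> * (1/2)^Suc k"
          using scaled by blast
        then show "\<exists>y'. (norm y' < \<epsilon> * (1/2)^Suc k \<and> (Suc k = 0 \<longrightarrow> y' = x)) \<and> norm (f (y - y')) \<le> K * (1/2)^k"
          by (intro exI[of _ "y - u"]) auto
      qed
      then show ?thesis using that by blast
    qed
    have geo: "summable (\<lambda>k. K * (1/2::real)^k)" by (intro summable_mult summable_geometric) auto
    have "summable (\<lambda>k. norm (f (X k - X (Suc k))))"
      by (rule summable_comparison_test[OF _ geo]) (use step in auto)
    then have sm: "summable (\<lambda>k. f (X k - X (Suc k)))" by (rule summable_norm_cancel)
    define y where "y = (\<Sum>k. f (X k - X (Suc k)))"
    have "(\<Sum>k<N. f (X k - X (Suc k))) = f x - f (X N)" for N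
      by (induction N) (auto simp: X0 diff)
    then have "(\<lambda>N. f x - f (X N)) \<longlonglongrightarrow> y"
      using summable_LIMSEQ[OF sm] by (simp add: y_def)
    from tendsto_diff[OF tendsto_const this, of "f x"] have "(\<lambda>N. f (X N)) \<longlonglongrightarrow> f x - y" by simp
    moreover have "X \<longlonglongrightarrow> 0"
    proof (rule Lim_null_comparison)
      show "\<forall>\<^sub>F k in sequentially. norm (X k) \<le> \<epsilon> * (1/2)^k"
        by (intro always_eventually allI less_imp_le X)
      show "(\<lambda>k. \<epsilon> * (1/2)^k) \<longlonglongrightarrow> 0" by (intro tendsto_mult_right_zero LIMSEQ_realpow_zero) auto
    qed
    ultimately have "f x = y" using closed by fastforce
    also have "norm y \<le> (\<Sum>k. K * (1/2)^k)"
      unfolding y_def by (rule norm_suminf_le) (use step geo in auto)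
    also have "\<dots> = 2 * K" by (subst suminf_mult) (auto simp: suminf_geometric)
    finally show ?thesis .
  qed
  show ?thesis
  proof (rule bounded_linear_intro)
    fix x
    show "norm (f x) \<le> norm x * (4 * K / \<epsilon>)"
    proof (cases "x = 0")
      case False
      define c where "c = \<epsilon> / (2 * norm x)"
      have "c > 0" using False \<epsilon> by (simp add: c_def)
      have "norm (c *\<^sub>R x) < \<epsilon>" using False \<epsilon> by (simp add: c_def)
      from bound[OF this] have "c * norm (f x) \<le> 2 * K" using \<open>c > 0\<close> by (simp add: scale)
      then show ?thesis using False \<epsilon> by (simp add: c_def field_simps)
    qed simp
  qed (auto simp: add scale)
qed

section \<open>Algebras with a right identity, commutative modulo the right annihilator\<close>

lemma rann_0: "0 \<in> rann"
  by (simp add: rann_def)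

lemma rann_add: "r \<in> rann \<Longrightarrow> s \<in> rann \<Longrightarrow> r + s \<in> rann"
  by (simp add: rann_def algebra_simps)

text \<open>Commutativity modulo \<open>rann\<close> means that any left factor absorbs commutators:
  \<open>a * (x * y) = a * (y * x)\<close>.\<close>

locale right_unital_algebra =
  fixes sm :: "complex \<Rightarrow> 'a::{real_normed_algebra,banach} \<Rightarrow> 'a" and e :: 'a
  assumes cba: "complex_banach_algebra sm"
    and right_id [simp]: "a * e = a"
    and commutator: "a * b - b * a \<in> rann"
begin

lemma sm_of_real: "sm (complex_of_real r) x = r *\<^sub>R x"
  and sm_add_right: "sm c (x + y) = sm c x + sm c y"
  and sm_add_left: "sm (c + d) x = sm c x + sm d x"
  and sm_sm: "sm c (sm d x) = sm (c * d) x"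
  and sm_mult_left: "sm c x * y = sm c (x * y)"
  and sm_mult_right: "x * sm c y = sm c (x * y)"
  and norm_sm: "norm (sm c x) = cmod c * norm x"
  using cba unfolding complex_banach_algebra_def by metis+

lemma sm_0 [simp]: "sm 0 x = 0"
  using sm_of_real[of 0] by simp

lemma sm_1 [simp]: "sm 1 x = x"
  using sm_of_real[of 1] by simp

lemma sm_zero_right [simp]: "sm c 0 = 0"
  using norm_sm[of c 0] by simp

lemma sm_diff_right: "sm c (x - y) = sm c x - sm c y"
  using sm_add_right[of c "x - y" y] by (simp add: algebra_simps)

lemma sm_diff_left: "sm (c - d) x = sm c x - sm d x"
  using sm_add_left[of "c - d" d x] by (simp add: algebra_simps)

lemma sm_sum_right: "sm c (sum f A) = (\<Sum>i\<in>A. sm c (f i))"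
  by (induction A rule: infinite_finite_induct) (auto simp: sm_add_right)

lemma sm_sum_left: "sm (sum f A) x = (\<Sum>i\<in>A. sm (f i) x)"
  by (induction A rule: infinite_finite_induct) (auto simp: sm_add_left)

lemma mult_left_id [simp]: "a * (e * x) = a * x"
  by (simp flip: mult.assoc)

lemma diff_left_id_in_rann: "x - e * x \<in> rann"
  by (simp add: rann_def right_diff_distrib)

lemma rann_fixed_zero: "r \<in> rann \<Longrightarrow> e * r = r \<Longrightarrow> r = 0"
  by (simp add: rann_def)

text \<open>A right quasi-inverse modulo \<open>rann\<close> becomes exact when its defect is
  subtracted, since \<open>u\<close> annihilates the defect. As commutators lie in
  \<open>rann\<close>, the same applies to \<open>y\<close>, and associativity identifies its right
  quasi-inverse with \<open>u\<close>.\<close>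

lemma quasi_invertibleI:
  fixes u :: 'a
  assumes "u + y - u * y \<in> rann"
  shows "quasi_invertible u"
proof -
  have correct: "\<exists>y'. u + y' - u * y' = 0" if "u + y - u * y \<in> rann" for u y :: 'a
  proof -
    define r where "r = u + y - u * y"
    have "u * r = 0" using that by (simp add: r_def rann_def)
    then have "u + (y - r) - u * (y - r) = u + y - u * y - r" by (simp add: right_diff_distrib)
    also have "\<dots> = 0" by (simp add: r_def)
    finally have "u + (y - r) - u * (y - r) = 0" .
    then show ?thesis by blast
  qed
  obtain y where y: "u + y - u * y = 0" using correct[OF assms] by blast
  have "y + u - y * u = u * y - y * u" using y by (simp add: algebra_simps)
  then have "y + u - y * u \<in> rann" using commutator by simp
  from correct[OF this] obtain z where z: "y + z - y * z = 0" by blast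
  have y': "u * y = u + y" and z': "y * z = y + z" using y z by simp_all
  have "(u * y) * z = u * (y * z)" by (simp add: mult.assoc)
  then have "u = z" using y' z' by (simp add: distrib_left distrib_right)
  with y z show ?thesis unfolding quasi_invertible_def by blast
qed

text \<open>The condition \<open>\<phi> e = 1\<close> excludes the zero functional. Continuity is
  automatic, by \<open>norm_character_le\<close>.\<close>

definition character :: "('a \<Rightarrow> complex) \<Rightarrow> bool" where
  "character \<phi> \<longleftrightarrow> (\<forall>x y. \<phi> (x + y) = \<phi> x + \<phi> y) \<and> (\<forall>c x. \<phi> (sm c x) = c * \<phi> x) \<and>
     (\<forall>x y. \<phi> (x * y) = \<phi> x * \<phi> y) \<and> \<phi> e = 1"

context
  fixes \<phi> assumes \<phi>: "character \<phi>"
begin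

lemma character_add [simp]: "\<phi> (x + y) = \<phi> x + \<phi> y"
  and character_sm [simp]: "\<phi> (sm c x) = c * \<phi> x"
  and character_mult [simp]: "\<phi> (x * y) = \<phi> x * \<phi> y"
  and character_id [simp]: "\<phi> e = 1"
  using \<phi> by (simp_all add: character_def)

lemma character_0 [simp]: "\<phi> 0 = 0"
  using character_add[of 0 0] by simp

lemma character_diff [simp]: "\<phi> (x - y) = \<phi> x - \<phi> y"
  using character_add[of "x - y" y] by simp

lemma character_scaleR [simp]: "\<phi> (r *\<^sub>R x) = of_real r * \<phi> x"
  using character_sm[of "of_real r" x] by (simp add: sm_of_real)

text \<open>Otherwise a multiple \<open>u\<close> of \<open>x\<close> has norm below 1 and
  \<open>\<phi> u = 1\<close>. The contraction sending \<open>y\<close> to \<open>u + u * y\<close>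
  has a fixed point, where \<open>\<phi>\<close> gives
  \<open>1 + \<phi> y = \<phi> y\<close>.\<close>

lemma norm_character_le: "cmod (\<phi> x) \<le> norm x"
proof (rule ccontr)
  assume *: "\<not> ?thesis"
  define u where "u = sm (1 / \<phi> x) x"
  have "\<phi> x \<noteq> 0" using * by auto
  then have u: "\<phi> u = 1" "norm u < 1"
    using * by (auto simp: u_def norm_sm norm_divide)
  have "\<exists>!y. u + u * y = y"
  proof (rule banach_fix_type)
    show "\<forall>y z. dist (u + u * y) (u + u * z) \<le> norm u * dist y z"
      by (auto simp: dist_norm norm_mult_ineq simp flip: right_diff_distrib)
  qed (use u in auto)
  then obtain y where "u + u * y = y" by blast
  then have "\<phi> (u + u * y) = \<phi> y" by simp
  then show False using u by simp
qed

end

end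

section \<open>Gelfand theory\<close>

text \<open>Ideals containing \<open>rann\<close> correspond to ideals of the commutative quotient,
  so stability under left multiplication makes them two-sided. \<open>M\<close> is not assumed to be
  closed.\<close>

locale proper_ideal = right_unital_algebra +
  fixes M
  assumes rann_subset: "rann \<subseteq> M"
    and add_mem: "x \<in> M \<Longrightarrow> y \<in> M \<Longrightarrow> x + y \<in> M"
    and sm_mem: "x \<in> M \<Longrightarrow> sm c x \<in> M"
    and mult_mem: "x \<in> M \<Longrightarrow> a * x \<in> M"
    and id_notin: "e \<notin> M"
begin

lemma zero_mem: "0 \<in> M"
  using rann_subset rann_0 by blast

lemma uminus_mem: "x \<in> M \<Longrightarrow> - x \<in> M"
  using sm_mem[of x "-1"] sm_of_real[of "-1" x] by simp

lemma diff_mem: "x \<in> M \<Longrightarrow> y \<in> M \<Longrightarrow> x - y \<in> M"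
  using add_mem[of x "-y"] uminus_mem by simp

lemma mult_right_mem: "x \<in> M \<Longrightarrow> x * a \<in> M"
  using add_mem[of "a * x" "x * a - a * x"] commutator rann_subset mult_mem by auto

section \<open>Congruence modulo the ideal\<close>

definition cong (infix "\<simeq>" 50) where "x \<simeq> y \<longleftrightarrow> x - y \<in> M"

lemma cong_refl [simp]: "x \<simeq> x"
  by (simp add: cong_def zero_mem)

lemma cong_sym: "x \<simeq> y \<Longrightarrow> y \<simeq> x"
  unfolding cong_def using uminus_mem by fastforce

lemma cong_trans [trans]: "x \<simeq> y \<Longrightarrow> y \<simeq> z \<Longrightarrow> x \<simeq> z"
  unfolding cong_def using add_mem[of "x - y" "y - z"] by simp

lemma cong_add: "x \<simeq> y \<Longrightarrow> x' \<simeq> y' \<Longrightarrow> x + x' \<simeq> y + y'"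
  unfolding cong_def using add_mem[of "x - y" "x' - y'"] by (simp add: algebra_simps)

lemma cong_diff: "x \<simeq> y \<Longrightarrow> x' \<simeq> y' \<Longrightarrow> x - x' \<simeq> y - y'"
  unfolding cong_def using diff_mem[of "x - y" "x' - y'"] by (simp add: algebra_simps)

lemma cong_sm: "x \<simeq> y \<Longrightarrow> sm c x \<simeq> sm c y"
  unfolding cong_def using sm_mem[of "x - y" c] by (simp add: sm_diff_right)

lemma cong_mult_left: "x \<simeq> y \<Longrightarrow> a * x \<simeq> a * y"
  unfolding cong_def using mult_mem[of "x - y" a] by (simp add: right_diff_distrib)

lemma cong_mult_right: "x \<simeq> y \<Longrightarrow> x * a \<simeq> y * a"
  unfolding cong_def using mult_right_mem[of "x - y" a] by (simp add: left_diff_distrib)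

lemma cong_commute: "x * y \<simeq> y * x"
  unfolding cong_def using commutator rann_subset by blast

lemma cong_left_id: "e * x \<simeq> x"
  using cong_commute[of e x] by simp

lemma cong_sum: "(\<And>i. i \<in> I \<Longrightarrow> f i \<simeq> g i) \<Longrightarrow> sum f I \<simeq> sum g I"
  by (induction I rule: infinite_finite_induct) (auto intro: cong_add)

text \<open>If \<open>v = e - m\<close> had norm below 1, the contraction sending \<open>y\<close>
  to \<open>e + v * y\<close> would have a fixed point, and solving the fixed point equation for
  \<open>e\<close> would place \<open>e\<close> in \<open>M\<close>.\<close>

lemma norm_id_diff_ge:
  assumes "m \<in> M"
  shows "norm (e - m) \<ge> 1"
proof (rule ccontr)
  assume *: "\<not> ?thesis"
  define v where "v = e - m"
  have "\<exists>!y. e + v * y = y"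
  proof (rule banach_fix_type)
    show "\<forall>y z. dist (e + v * y) (e + v * z) \<le> norm v * dist y z"
      by (auto simp: dist_norm norm_mult_ineq simp flip: right_diff_distrib)
  qed (use * in \<open>auto simp: v_def\<close>)
  then obtain y where "e + v * y = y" by blast
  then have "e = (y - e * y) + m * y" by (simp add: v_def algebra_simps)
  also have "\<dots> \<in> M"
    using add_mem diff_left_id_in_rann rann_subset mult_right_mem assms by blast
  finally show False using id_notin by blast
qed

text \<open>The quotient seminorm of A / M.\<close>

definition q where "q x = infdist x M"

lemma q_nonneg: "q x \<ge> 0"
  by (simp add: q_def infdist_nonneg)

lemma le_q: "(\<And>m. m \<in> M \<Longrightarrow> K \<le> norm (x - m)) \<Longrightarrow> K \<le> q x"
  using zero_mem unfolding q_def
  by (subst infdist_notempty) (auto intro!: cINF_greatest simp: dist_norm)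

lemma q_le: "x \<simeq> y \<Longrightarrow> q x \<le> norm y"
  unfolding q_def cong_def by (rule infdist_le2) (auto simp: dist_norm)

lemma q_cong: "x \<simeq> y \<Longrightarrow> q x \<le> q y"
proof (rule le_q)
  fix m assume "x \<simeq> y" "m \<in> M"
  then have "x \<simeq> y - m" unfolding cong_def using add_mem[of "x - y" m] by (simp add: algebra_simps)
  then show "q x \<le> norm (y - m)" by (rule q_le)
qed

lemma q_id_ge: "q e \<ge> 1"
  by (rule le_q) (rule norm_id_diff_ge)

lemma le_q_mult:
  assumes "c \<ge> 0" "\<And>m. m \<in> M \<Longrightarrow> K \<le> c * norm (x - m)"
  shows "K \<le> c * q x"
proof (cases "c = 0")
  case True
  then show ?thesis using assms(2)[OF zero_mem] by simp
next
  case False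
  then have "K / c \<le> q x" using assms by (intro le_q) (auto simp: field_simps)
  then show ?thesis using False assms by (simp add: field_simps)
qed

lemma q_add: "q (x + y) \<le> q x + q y"
proof -
  have "q (x + y) - q y \<le> q x"
  proof (rule le_q)
    fix m assume m: "m \<in> M"
    have "q (x + y) - norm (x - m) \<le> q y"
    proof (rule le_q)
      fix n assume n: "n \<in> M"
      have "q (x + y) \<le> norm ((x - m) + (y - n))"
        by (rule q_le) (use add_mem[OF m n] in \<open>simp add: cong_def algebra_simps\<close>)
      then show "q (x + y) - norm (x - m) \<le> norm (y - n)"
        using norm_triangle_ineq[of "x - m" "y - n"] by linarith
    qed
    then show "q (x + y) - q y \<le> norm (x - m)" by simp
  qed
  then show ?thesis by simp
qed

lemma q_sm: "q (sm c x) \<le> cmod c * q x"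
proof (rule le_q_mult)
  fix m assume "m \<in> M"
  then show "q (sm c x) \<le> cmod c * norm (x - m)"
    using q_le[of "sm c x" "sm c (x - m)"]
    by (simp add: norm_sm) (simp add: cong_def sm_diff_right sm_mem norm_sm)
qed simp

lemma q_diff: "q (x - y) \<le> q x + q y"
  using q_add[of x "sm (-1) y"] q_sm[of "-1" y] sm_of_real[of "-1" y] by simp

lemma q_sum: "q (sum f I) \<le> (\<Sum>i\<in>I. q (f i))"
proof (induction I rule: infinite_finite_induct)
  case (insert i I)
  then show ?case using q_add[of "f i" "sum f I"] by simp
qed (use q_le[of 0 0] in auto)

lemma q_mult: "q (x * y) \<le> q x * q y"
proof (rule le_q_mult[OF q_nonneg])
  fix n assume n: "n \<in> M"
  have "q (x * y) \<le> norm (y - n) * q x"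
  proof (rule le_q_mult)
    fix m assume m: "m \<in> M"
    have "x * y \<simeq> (x - m) * y"
      using m unfolding cong_def by (simp add: left_diff_distrib mult_right_mem)
    also have "\<dots> \<simeq> (x - m) * (y - n)"
      using n unfolding cong_def by (simp add: mult_mem flip: right_diff_distrib)
    finally have "q (x * y) \<le> norm ((x - m) * (y - n))" by (rule q_le)
    also have "\<dots> \<le> norm (y - n) * norm (x - m)"
      using norm_mult_ineq[of "x - m" "y - n"] by (simp add: mult.commute)
    finally show "q (x * y) \<le> norm (y - n) * norm (x - m)" .
  qed simp
  then show "q (x * y) \<le> q x * norm (y - n)" by (simp add: mult.commute)
qed

end

section \<open>Sums over roots of unity\<close>

lemma sum_powers_of_root_of_unity:
  fixes \<omega> :: complex
  assumes "\<omega> ^ n = 1" "\<omega> ^ j \<noteq> 1"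
  shows "(\<Sum>k<n. (\<omega> ^ k) ^ j) = 0"
proof -
  have "(\<omega> ^ j) ^ n = 1" using assms by (simp flip: power_mult add: mult.commute[of j]) (simp add: power_mult)
  then have "(\<Sum>k<n. (\<omega> ^ j) ^ k) = 0" using assms(2) by (subst geometric_sum) auto
  then show ?thesis by (simp flip: power_mult add: mult.commute)
qed

lemma cis_primitive_root:
  fixes j n :: nat
  assumes "0 < j" "j < n"
  shows "cis (2 * pi / n) ^ j \<noteq> 1"
proof
  assume "cis (2 * pi / n) ^ j = 1"
  then have eq: "cis (2 * pi * real j / n) = cis (2 * pi * real 0 / n)"
    unfolding Complex.DeMoivre by (simp add: mult.commute)
  have "inj_on (\<lambda>k. cis (2 * pi * real k / real n)) {..<n}"
    using Complex.bij_betw_roots_unity[of n] assms by (simp add: bij_betw_def)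
  from inj_onD[OF this eq] show False using assms by simp
qed

section \<open>Nonemptiness of the spectrum modulo the ideal\<close>

context proper_ideal
begin

text \<open>The norm \<open>N\<close> of the resolvent cannot have a maximum unless it is locally constant: averaging
  the resolvent over the \<open>n\<close>-th roots of \<open>\<mu>\<^sup>n\<close> gives \<open>N (\<zeta> + \<mu>) \<ge> m - n m \<tau>\<^sup>n\<close> with \<open>\<tau> < 1\<close>.\<close>

lemma resolvent_norm_max_stable:
  assumes r: "\<And>\<zeta>. (b - sm \<zeta> e) * r \<zeta> \<simeq> e"
    and max: "\<And>\<zeta>. q (r \<zeta>) \<le> m" and max_at: "q (r \<zeta>\<^sub>0) = m" and \<mu>: "cmod \<mu> * m < 1"
  shows "q (r (\<zeta>\<^sub>0 + \<mu>)) = m"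
proof (rule antisym[OF max])
  \<comment> \<open>The resolvent identity modulo \<open>M\<close>: \<open>b - sm \<zeta> e\<close>
    is split as \<open>(b - sm (\<zeta> + z) e) + sm z e\<close>.\<close>
  have resolvent: "r (\<zeta> + z) \<simeq> r \<zeta> + sm z (r \<zeta> * r (\<zeta> + z))" for \<zeta> z
  proof -
    let ?s = "r (\<zeta> + z)"
    have "?s \<simeq> e * ?s" by (rule cong_sym[OF cong_left_id])
    also have "\<dots> \<simeq> (b - sm \<zeta> e) * r \<zeta> * ?s" by (intro cong_mult_right cong_sym[OF r])
    also have "\<dots> \<simeq> r \<zeta> * (b - sm \<zeta> e) * ?s" by (intro cong_mult_right cong_commute)
    also have "\<dots> = r \<zeta> * ((b - sm (\<zeta> + z) e) * ?s) + sm z (r \<zeta> * ?s)"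
      by (simp add: sm_add_left sm_mult_left sm_mult_right sm_add_right algebra_simps sm_diff_right)
    also have "\<dots> \<simeq> r \<zeta> * e + sm z (r \<zeta> * ?s)"
      by (intro cong_add cong_mult_left cong_refl r)
    finally show ?thesis by simp
  qed
  define \<rho> where "\<rho> = r \<zeta>\<^sub>0"
  \<comment> \<open>\<open>P j \<rho>\<close> plays the role of the power of \<open>\<rho>\<close>
    with exponent \<open>j + 1\<close>; without a unit, powers become iterated left
    multiplications.\<close>
  define P where "P j = ((*) \<rho> ^^ j)" for j
  have m0: "m \<ge> 0" using max_at q_nonneg by metis
  have P_add: "P j (x + y) = P j x + P j y" for j x y
    by (induction j) (auto simp: P_def distrib_left)
  have P_cong: "x \<simeq> y \<Longrightarrow> P j x \<simeq> P j y" for j x y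
    by (induction j) (auto simp: P_def cong_mult_left)
  have P_sm: "P j (sm c x) = sm c (P j x)" for j c x
    by (induction j) (auto simp: P_def sm_mult_right)
  have P_sum: "P j (sum f I) = (\<Sum>i\<in>I. P j (f i))" for j f and I :: "nat set"
  proof -
    have "P j 0 = 0" by (induction j) (auto simp: P_def)
    then show ?thesis by (induction I rule: infinite_finite_induct) (auto simp: P_add)
  qed
  have P_mult: "P j (\<rho> * x) = P (Suc j) x" for j x
    by (simp add: P_def funpow_swap1)
  have q_P: "q (P j x) \<le> m ^ j * q x" for j x
  proof (induction j)
    case (Suc j)
    have "q (P (Suc j) x) \<le> q \<rho> * q (P j x)" by (simp add: P_def q_mult)
    also have "\<dots> \<le> m * (m ^ j * q x)"
      using Suc max_at m0 by (intro mult_mono) (auto simp: \<rho>_def q_nonneg)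
    finally show ?case by (simp add: mult_ac)
  qed (simp add: P_def)
  \<comment> \<open>Iterating the resolvent identity yields the Neumann expansion at
    \<open>\<zeta>\<^sub>0\<close> with its exact remainder.\<close>
  have expand: "r (\<zeta>\<^sub>0 + z) \<simeq> (\<Sum>j<n. sm (z ^ j) (P j \<rho>)) + sm (z ^ n) (P n (r (\<zeta>\<^sub>0 + z)))" for z n
  proof (induction n)
    case (Suc n)
    note Suc
    also have "(\<Sum>j<n. sm (z ^ j) (P j \<rho>)) + sm (z ^ n) (P n (r (\<zeta>\<^sub>0 + z)))
      \<simeq> (\<Sum>j<n. sm (z ^ j) (P j \<rho>)) + sm (z ^ n) (P n (\<rho> + sm z (\<rho> * r (\<zeta>\<^sub>0 + z))))"
      using resolvent[of \<zeta>\<^sub>0 z] by (intro cong_add cong_sm P_cong cong_refl) (simp add: \<rho>_def)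
    also have "\<dots> = (\<Sum>j<Suc n. sm (z ^ j) (P j \<rho>)) + sm (z ^ Suc n) (P (Suc n) (r (\<zeta>\<^sub>0 + z)))"
      by (simp add: P_add P_sm P_mult sm_add_right sm_sm mult_ac add_ac)
    finally show ?case .
  qed (simp add: P_def)
  define \<tau> where "\<tau> = cmod \<mu> * m"
  have \<tau>: "0 \<le> \<tau>" "\<tau> < 1" using \<mu> m0 by (auto simp: \<tau>_def)
  have key: "m - real n * m * \<tau> ^ n \<le> q (r (\<zeta>\<^sub>0 + \<mu>))" if n: "n > 0" for n
  proof -
    define \<omega> where "\<omega> = cis (2 * pi / n)"
    have \<omega>: "\<omega> ^ n = 1" using n by (simp add: \<omega>_def Complex.DeMoivre)
    \<comment> \<open>The \<open>z k\<close> run through the \<open>n\<close>-th roots of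
      \<open>\<mu> ^ n\<close>, starting with \<open>z 0 = \<mu>\<close>. Summing over them kills
      the powers strictly between 0 and \<open>n\<close>, and all remainders share the factor
      \<open>\<mu> ^ n\<close>.\<close>
    define z where "z k = \<omega> ^ k * \<mu>" for k
    define s where "s = (\<Sum>k<n. r (\<zeta>\<^sub>0 + z k))"
    have zn: "z k ^ n = \<mu> ^ n" for k
      using \<omega> by (simp add: z_def power_mult_distrib flip: power_mult)
        (simp add: mult.commute[of k] power_mult)
    have zj: "(\<Sum>k<n. z k ^ j) = (if j = 0 then of_nat n else 0)" if "j < n" for j
      using that \<omega> cis_primitive_root[of j n] sum_powers_of_root_of_unity[of \<omega> n j]
      by (auto simp: z_def power_mult_distrib \<omega>_def simp flip: sum_distrib_right)
    have "s \<simeq> (\<Sum>k<n. (\<Sum>j<n. sm (z k ^ j) (P j \<rho>)) + sm (z k ^ n) (P n (r (\<zeta>\<^sub>0 + z k))))"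
      unfolding s_def by (intro cong_sum expand)
    also have "\<dots> = (\<Sum>k<n. \<Sum>j<n. sm (z k ^ j) (P j \<rho>)) + sm (\<mu> ^ n) (P n s)"
      by (simp add: sum.distrib zn s_def P_sum sm_sum_right)
    also have "(\<Sum>k<n. \<Sum>j<n. sm (z k ^ j) (P j \<rho>)) = (\<Sum>j<n. sm (\<Sum>k<n. z k ^ j) (P j \<rho>))"
      by (subst sum.swap) (simp add: sm_sum_left)
    also have "\<dots> = (\<Sum>j<n. if j = 0 then sm (of_nat n) \<rho> else 0)"
      by (intro sum.cong refl) (simp add: zj P_def)
    also have "\<dots> = sm (of_nat n) \<rho>" using n by simp
    finally have "s - sm (\<mu> ^ n) (P n s) \<simeq> sm (of_nat n) \<rho>"
      by (auto simp: cong_def algebra_simps)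
    from cong_sm[OF cong_sym[OF this], of "1 / of_nat n"]
    have "\<rho> \<simeq> sm (1 / of_nat n) (s - sm (\<mu> ^ n) (P n s))" using n by (simp add: sm_sm)
    then have "q \<rho> \<le> q (sm (1 / of_nat n) (s - sm (\<mu> ^ n) (P n s)))" by (rule q_cong)
    also have "\<dots> \<le> (1 / n) * q (s - sm (\<mu> ^ n) (P n s))"
      using q_sm[of "1 / of_nat n"] by (simp add: norm_divide)
    finally have "n * m \<le> q (s - sm (\<mu> ^ n) (P n s))" using n max_at by (simp add: \<rho>_def field_simps)
    also have "\<dots> \<le> q s + cmod (\<mu> ^ n) * q (P n s)"
      using q_diff[of s "sm (\<mu> ^ n) (P n s)"] q_sm[of "\<mu> ^ n" "P n s"] by linarith
    also have "\<dots> \<le> q s + cmod (\<mu> ^ n) * (m ^ n * q s)"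
      by (intro add_left_mono mult_left_mono q_P) auto
    also have "\<dots> = q s + \<tau> ^ n * q s" by (simp add: \<tau>_def norm_power power_mult_distrib)
    finally have 1: "n * m \<le> q s + \<tau> ^ n * q s" .
    have "q s \<le> (\<Sum>k<n. q (r (\<zeta>\<^sub>0 + z k)))" unfolding s_def by (rule q_sum)
    also have "\<dots> = q (r (\<zeta>\<^sub>0 + z 0)) + (\<Sum>k\<in>{..<n} - {0}. q (r (\<zeta>\<^sub>0 + z k)))"
      using n by (intro sum.remove) auto
    also have "\<dots> \<le> q (r (\<zeta>\<^sub>0 + \<mu>)) + (\<Sum>k\<in>{..<n} - {0}. m)"
      by (intro add_mono sum_mono max) (simp add: z_def)
    also have "\<dots> = q (r (\<zeta>\<^sub>0 + \<mu>)) + (n - 1) * m" using n by simp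
    finally have 2: "q s \<le> q (r (\<zeta>\<^sub>0 + \<mu>)) + (real n - 1) * m" using n by (simp add: of_nat_diff)
    also have "\<dots> \<le> n * m" using max[of "\<zeta>\<^sub>0 + \<mu>"] by (simp add: algebra_simps)
    finally have "\<tau> ^ n * q s \<le> \<tau> ^ n * (n * m)" using \<tau> by (intro mult_left_mono) auto
    then show ?thesis using 1 2 by (simp add: algebra_simps)
  qed
  have "(\<lambda>n. m - m * (real n * \<tau> ^ n)) \<longlonglongrightarrow> m - m * 0"
    using \<tau> by (intro tendsto_intros powser_times_n_limit_0) auto
  then have lim: "(\<lambda>n. m - real n * m * \<tau> ^ n) \<longlonglongrightarrow> m" by (simp add: mult_ac)
  show "m \<le> q (r (\<zeta>\<^sub>0 + \<mu>))"
    by (rule tendsto_upperbound[OF lim]) (auto intro!: eventually_sequentiallyI[of 1] key)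
qed

text \<open>Gelfand--Mazur for the quotient by a proper ideal.\<close>

lemma spectrum_nonempty: "\<exists>\<zeta>. \<forall>c. \<not> (b - sm \<zeta> e) * c \<simeq> e"
proof (rule ccontr)
  assume "\<not> ?thesis"
  then have "\<forall>\<zeta>. \<exists>c. (b - sm \<zeta> e) * c \<simeq> e" by blast
  then obtain r where r: "\<And>\<zeta>. (b - sm \<zeta> e) * r \<zeta> \<simeq> e" by metis
  \<comment> \<open>The reciprocal of the resolvent seminorm is 1-Lipschitz and grows at least
    linearly, so it attains its minimum; there the resolvent seminorm is maximal.\<close>
  define g where "g \<zeta> = 1 / q (r \<zeta>)" for \<zeta>
  have N_pos: "q (r \<zeta>) > 0" for \<zeta>
  proof -
    have "1 \<le> q e" by (rule q_id_ge)
    also have "\<dots> \<le> q ((b - sm \<zeta> e) * r \<zeta>)" by (rule q_cong[OF cong_sym[OF r]])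
    also have "\<dots> \<le> q (b - sm \<zeta> e) * q (r \<zeta>)" by (rule q_mult)
    finally show ?thesis using q_nonneg[of "r \<zeta>"] by (cases "q (r \<zeta>) = 0") auto
  qed
  have lip: "q (r \<zeta>) - q (r \<mu>) \<le> cmod (\<zeta> - \<mu>) * q (r \<zeta>) * q (r \<mu>)" for \<zeta> \<mu>
  proof -
    have "r \<zeta> \<simeq> e * r \<zeta>" by (rule cong_sym[OF cong_left_id])
    also have "\<dots> \<simeq> (b - sm \<mu> e) * r \<mu> * r \<zeta>" by (intro cong_mult_right cong_sym[OF r])
    also have "\<dots> \<simeq> r \<mu> * (b - sm \<mu> e) * r \<zeta>" by (intro cong_mult_right cong_commute)
    also have "\<dots> = r \<mu> * ((b - sm \<zeta> e) * r \<zeta>) + sm (\<zeta> - \<mu>) (r \<mu> * r \<zeta>)"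
      by (simp add: sm_diff_left sm_mult_left sm_mult_right algebra_simps sm_diff_right)
    also have "\<dots> \<simeq> r \<mu> * e + sm (\<zeta> - \<mu>) (r \<mu> * r \<zeta>)"
      by (intro cong_add cong_mult_left cong_refl r)
    finally have "q (r \<zeta>) \<le> q (r \<mu> + sm (\<zeta> - \<mu>) (r \<mu> * r \<zeta>))" by (simp add: q_cong)
    also have "\<dots> \<le> q (r \<mu>) + cmod (\<zeta> - \<mu>) * q (r \<mu> * r \<zeta>)"
      using q_add q_sm by (meson add_left_mono order_trans)
    also have "\<dots> \<le> q (r \<mu>) + cmod (\<zeta> - \<mu>) * (q (r \<mu>) * q (r \<zeta>))"
      by (intro add_left_mono mult_left_mono q_mult) auto
    finally show ?thesis by (simp add: mult_ac)
  qed
  have "g \<mu> - g \<zeta> \<le> cmod (\<zeta> - \<mu>)" for \<zeta> \<mu>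
    using lip[of \<zeta> \<mu>] N_pos[of \<zeta>] N_pos[of \<mu>] by (simp add: g_def field_simps)
  then have "dist (g \<zeta>) (g \<mu>) \<le> 1 * dist \<zeta> \<mu>" for \<zeta> \<mu>
    by (smt (verit) dist_commute dist_norm real_norm_def)
  then have "1-lipschitz_on UNIV g" by (intro lipschitz_onI) auto
  then have cont: "continuous_on UNIV g" by (rule lipschitz_on_continuous_on)
  have far: "cmod \<zeta> \<le> q b + q e * g \<zeta>" for \<zeta>
  proof (cases "\<zeta> = 0")
    case False
    have "sm \<zeta> (r \<zeta>) \<simeq> sm \<zeta> (e * r \<zeta>)" by (intro cong_sm cong_sym[OF cong_left_id])
    also have "\<dots> = b * r \<zeta> - (b - sm \<zeta> e) * r \<zeta>" by (simp add: algebra_simps sm_mult_left)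
    also have "\<dots> \<simeq> b * r \<zeta> - e" by (intro cong_diff cong_refl r)
    finally have "r \<zeta> \<simeq> sm (1/\<zeta>) (b * r \<zeta> - e)"
      using cong_sm[of "sm \<zeta> (r \<zeta>)" _ "1/\<zeta>"] False by (simp add: sm_sm)
    then have "q (r \<zeta>) \<le> q (sm (1/\<zeta>) (b * r \<zeta> - e))" by (rule q_cong)
    also have "\<dots> \<le> (1 / cmod \<zeta>) * q (b * r \<zeta> - e)" using q_sm[of "1/\<zeta>"] by (simp add: norm_divide)
    also have "\<dots> \<le> (1 / cmod \<zeta>) * (q b * q (r \<zeta>) + q e)"
      using q_diff[of "b * r \<zeta>" e] q_mult[of b "r \<zeta>"] by (intro mult_left_mono) auto
    finally show ?thesis using False N_pos[of \<zeta>] by (simp add: g_def field_simps)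
  qed (use q_nonneg N_pos[of \<zeta>] in \<open>auto simp: g_def\<close>)
  \<comment> \<open>Outside the disc of radius \<open>\<rho>\<close> the growth bound makes
    \<open>g\<close> exceed \<open>g 0\<close>, so the minimum over the disc is global.\<close>
  define \<rho> where "\<rho> = q b + q e * g 0"
  have "\<rho> \<ge> 0" using q_nonneg N_pos[of 0] by (auto simp: \<rho>_def g_def)
  then obtain \<zeta>\<^sub>0 where \<zeta>\<^sub>0: "\<And>\<zeta>. \<zeta> \<in> cball 0 \<rho> \<Longrightarrow> g \<zeta>\<^sub>0 \<le> g \<zeta>"
    using continuous_attains_inf[of "cball 0 \<rho>" g] continuous_on_subset[OF cont]
    by (metis cball_eq_empty compact_cball linorder_not_less subset_UNIV)
  have min: "g \<zeta>\<^sub>0 \<le> g \<zeta>" for \<zeta>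
  proof (cases "\<zeta> \<in> cball 0 \<rho>")
    case False
    then have "q e * g 0 \<le> q e * g \<zeta>" using far[of \<zeta>] by (simp add: \<rho>_def)
    then have "g 0 \<le> g \<zeta>" using q_id_ge by simp
    then show ?thesis using \<zeta>\<^sub>0[of 0] \<open>\<rho> \<ge> 0\<close> by simp
  qed (use \<zeta>\<^sub>0 in auto)
  define m where "m = q (r \<zeta>\<^sub>0)"
  have max: "q (r \<zeta>) \<le> m" for \<zeta>
    using min[of \<zeta>] N_pos[of \<zeta>] N_pos[of \<zeta>\<^sub>0] by (simp add: m_def g_def field_simps)
  have m: "m > 0" using N_pos by (simp add: m_def)
  \<comment> \<open>Steps of length \<open>1 / (2 * m)\<close> are within reach of
    \<open>resolvent_norm_max_stable\<close>, so the maximum is carried arbitrarily far in the real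
    direction, where the growth bound forbids it.\<close>
  have const: "q (r (\<zeta>\<^sub>0 + of_real (real k / (2 * m)))) = m" for k
  proof (induction k)
    case (Suc k)
    have "cmod (of_real (1 / (2 * m))) * m < 1" using m by (simp add: norm_divide)
    from resolvent_norm_max_stable[OF r max Suc this] show ?case
      by (simp add: add_divide_distrib add_ac)
  qed (simp add: m_def)
  obtain k :: nat where k: "real k > 2 * m * (cmod \<zeta>\<^sub>0 + q b + q e / m)"
    using reals_Archimedean2 by blast
  have "real k / (2 * m) \<le> cmod \<zeta>\<^sub>0 + cmod (\<zeta>\<^sub>0 + of_real (real k / (2 * m)))"
    using norm_triangle_ineq4[of "\<zeta>\<^sub>0 + of_real (real k / (2 * m))" \<zeta>\<^sub>0] m
    by (simp add: norm_divide norm_mult)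
  also have "\<dots> \<le> cmod \<zeta>\<^sub>0 + (q b + q e / m)"
    using far[of "\<zeta>\<^sub>0 + of_real (real k / (2 * m))"] const[of k] by (simp add: g_def)
  finally have "real k \<le> 2 * m * (cmod \<zeta>\<^sub>0 + q b + q e / m)"
    using m by (simp add: pos_divide_le_eq mult_ac add.assoc)
  then show False using k by simp
qed

end

section \<open>Maximal ideals, characters and the radical\<close>

context right_unital_algebra
begin

lemma proper_idealI:
  assumes "rann \<subseteq> M" "\<And>x y. x \<in> M \<Longrightarrow> y \<in> M \<Longrightarrow> x + y \<in> M"
    "\<And>x c. x \<in> M \<Longrightarrow> sm c x \<in> M" "\<And>x a. x \<in> M \<Longrightarrow> a * x \<in> M" "e \<notin> M"
  shows "proper_ideal sm e M"
  by unfold_locales (use assms in auto)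

text \<open>Zorn's lemma applies because the union of a chain of ideals omitting \<open>e\<close>
  omits \<open>e\<close>.\<close>

lemma maximal_ideal_exists:
  assumes "proper_ideal sm e I"
  obtains M where "proper_ideal sm e M" "I \<subseteq> M"
    "\<forall>J. proper_ideal sm e J \<longrightarrow> M \<subseteq> J \<longrightarrow> J = M"
proof -
  define \<A> where "\<A> = {J. proper_ideal sm e J \<and> I \<subseteq> J}"
  have "\<exists>M\<in>\<A>. \<forall>X\<in>\<A>. M \<subseteq> X \<longrightarrow> X = M"
  proof (rule subset_Zorn_nonempty)
    show "\<A> \<noteq> {}" using assms by (auto simp: \<A>_def)
  next
    fix \<C> assume ne: "\<C> \<noteq> {}" and ch: "subset.chain \<A> \<C>"
    have C: "proper_ideal sm e J" "I \<subseteq> J" if "J \<in> \<C>" for J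
      using that ch by (auto simp: \<A>_def subset_chain_def)
    have "proper_ideal sm e (\<Union>\<C>)"
    proof (rule proper_idealI)
      show "rann \<subseteq> \<Union>\<C>" using ne proper_ideal.rann_subset[OF C(1)] by fast
      show "e \<notin> \<Union>\<C>" using proper_ideal.id_notin[OF C(1)] by fast
    next
      fix x y assume "x \<in> \<Union>\<C>" "y \<in> \<Union>\<C>"
      then obtain J where "J \<in> \<C>" "x \<in> J" "y \<in> J"
        using ch unfolding subset_chain_def by blast
      then show "x + y \<in> \<Union>\<C>" using proper_ideal.add_mem[OF C(1)] by fast
    next
      fix x c assume "x \<in> \<Union>\<C>"
      then show "sm c x \<in> \<Union>\<C>" using proper_ideal.sm_mem[OF C(1)] by fast
    next
      fix x a assume "x \<in> \<Union>\<C>"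
      then show "a * x \<in> \<Union>\<C>" using proper_ideal.mult_mem[OF C(1)] by fast
    qed
    then show "\<Union>\<C> \<in> \<A>" using ne C(2) by (fastforce simp: \<A>_def)
  qed
  then obtain M where M: "M \<in> \<A>" "\<forall>X\<in>\<A>. M \<subseteq> X \<longrightarrow> X = M" by blast
  then have "I \<subseteq> M" by (simp add: \<A>_def)
  with M show ?thesis using that[of M] by (auto simp: \<A>_def)
qed

text \<open>Maximality makes A / M a field, and by \<open>spectrum_nonempty\<close> every
  \<open>x\<close> is congruent to a scalar multiple of \<open>e\<close>; that scalar is the value
  of the character.\<close>

lemma character_of_maximal_ideal:
  assumes "proper_ideal sm e M" and max: "\<forall>J. proper_ideal sm e J \<longrightarrow> M \<subseteq> J \<longrightarrow> J = M"
  obtains \<phi> where "character \<phi>" "\<And>x. x \<in> M \<Longrightarrow> \<phi> x = 0"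
proof -
  interpret proper_ideal sm e M by fact
  have inv: "\<exists>c. b * c \<simeq> e" if b: "b \<notin> M" for b
  proof (rule ccontr)
    assume no: "\<not> ?thesis"
    \<comment> \<open>\<open>J\<close> is the ideal generated by \<open>b\<close> and
      \<open>M\<close>; if it contained \<open>e\<close>, then \<open>b\<close> would be invertible
      modulo \<open>M\<close>.\<close>
    define J where "J = {c * b + m | c m. m \<in> M}"
    have "proper_ideal sm e J"
    proof (rule proper_idealI)
      show "rann \<subseteq> J"
      proof
        fix x :: 'a assume "x \<in> rann"
        then have "x = 0 * b + x \<and> x \<in> M" using rann_subset by auto
        then show "x \<in> J" unfolding J_def by blast
      qed
      show "e \<notin> J"
      proof
        assume "e \<in> J"
        then obtain c m where m: "m \<in> M" and "e = c * b + m" by (auto simp: J_def)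
        then have "c * b - e = - m" by simp
        then have "c * b \<simeq> e" using m uminus_mem by (simp add: cong_def)
        then have "b * c \<simeq> e" using cong_commute cong_trans by blast
        then show False using no by blast
      qed
    next
      fix x y assume "x \<in> J" "y \<in> J"
      then obtain c m d n where "m \<in> M" "n \<in> M" "x = c * b + m" "y = d * b + n"
        by (auto simp: J_def)
      then have "x + y = (c + d) * b + (m + n) \<and> m + n \<in> M" by (simp add: distrib_right add_mem)
      then show "x + y \<in> J" unfolding J_def by blast
    next
      fix x k assume "x \<in> J"
      then obtain c m where "m \<in> M" "x = c * b + m" by (auto simp: J_def)
      then have "sm k x = sm k c * b + sm k m \<and> sm k m \<in> M"
        by (simp add: sm_add_right sm_mult_left sm_mem)
      then show "sm k x \<in> J" unfolding J_def by blast
    next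
      fix x a assume "x \<in> J"
      then obtain c m where "m \<in> M" "x = c * b + m" by (auto simp: J_def)
      then have "a * x = (a * c) * b + a * m \<and> a * m \<in> M"
        by (simp add: distrib_left mult.assoc mult_mem)
      then show "a * x \<in> J" unfolding J_def by blast
    qed
    moreover have "M \<subseteq> J"
    proof
      fix x assume "x \<in> M"
      then have "x = 0 * b + x \<and> x \<in> M" by simp
      then show "x \<in> J" unfolding J_def by blast
    qed
    ultimately have "J = M" using max by blast
    have "b = e * b + (b - e * b) \<and> b - e * b \<in> M"
      using diff_left_id_in_rann rann_subset by auto
    then have "b \<in> J" unfolding J_def by blast
    then show False using b \<open>J = M\<close> by simp
  qed
  have "\<exists>c. x \<simeq> sm c e" for x
    using spectrum_nonempty[of x] inv unfolding cong_def by blast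
  then obtain \<phi> where \<phi>: "\<And>x. x \<simeq> sm (\<phi> x) e" by metis
  \<comment> \<open>As \<open>e\<close> is not in \<open>M\<close>, the scalar is unique, and each
    law for \<open>\<phi>\<close> reduces to a congruence.\<close>
  have unique: "\<phi> x = c" if "x \<simeq> sm c e" for x c
  proof (rule ccontr)
    assume ne: "\<phi> x \<noteq> c"
    have "sm (\<phi> x) e \<simeq> sm c e" using cong_trans[OF cong_sym[OF \<phi>] that] .
    then have "sm (\<phi> x - c) e \<in> M" by (simp add: cong_def sm_diff_left)
    from sm_mem[OF this, of "1 / (\<phi> x - c)"] have "e \<in> M" using ne by (simp add: sm_sm)
    then show False using id_notin by simp
  qed
  have "character \<phi>"
    unfolding character_def
  proof (intro conjI allI unique)
    show "x + y \<simeq> sm (\<phi> x + \<phi> y) e" for x y unfolding sm_add_left by (intro cong_add \<phi>)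
    show "sm c x \<simeq> sm (c * \<phi> x) e" for c x unfolding sm_sm[symmetric] by (intro cong_sm \<phi>)
    show "x * y \<simeq> sm (\<phi> x * \<phi> y) e" for x y
    proof -
      have "x * y \<simeq> x * sm (\<phi> y) e" by (intro cong_mult_left \<phi>)
      also have "\<dots> = sm (\<phi> y) x" by (simp add: sm_mult_right)
      also have "\<dots> \<simeq> sm (\<phi> y) (sm (\<phi> x) e)" by (intro cong_sm \<phi>)
      finally show ?thesis by (simp add: sm_sm mult.commute)
    qed
  qed simp
  moreover have "\<phi> x = 0" if "x \<in> M" for x
    by (rule unique) (use that in \<open>simp add: cong_def\<close>)
  ultimately show ?thesis using that by blast
qed

text \<open>If \<open>u = a * x\<close> is not quasi-invertible, the ideal A (1 - u) +
  \<open>rann\<close> is proper. A character vanishing on a maximal ideal above it takes the value 1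
  at \<open>u\<close>, so it is nonzero at \<open>x\<close>.\<close>

lemma characters_separate_modulo_jrad:
  assumes x: "\<And>\<phi>. character \<phi> \<Longrightarrow> \<phi> x = 0"
  shows "x \<in> jrad"
  unfolding jrad_def mem_Collect_eq
proof (rule allI, rule ccontr)
  fix a assume not_qi: "\<not> quasi_invertible (a * x)"
  define u where "u = a * x"
  define I where "I = {c - c * u + r | c r. r \<in> rann}"
  have "proper_ideal sm e I"
  proof (rule proper_idealI)
    show "rann \<subseteq> I"
    proof
      fix y :: 'a assume "y \<in> rann"
      then have "y = 0 - 0 * u + y \<and> y \<in> rann" by simp
      then show "y \<in> I" unfolding I_def by blast
    qed
    show "e \<notin> I"
    proof
      assume "e \<in> I"
      then obtain c r where r: "r \<in> rann" and "e = c - c * u + r" by (auto simp: I_def)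
      \<comment> \<open>The equation for \<open>e\<close> makes \<open>e - c\<close> a quasi-inverse
        of \<open>u\<close> modulo \<open>rann\<close>.\<close>
      then have "u + (e - c) - u * (e - c) = r + (u * c - c * u)" by (simp add: algebra_simps)
      also have "\<dots> \<in> rann" by (intro rann_add r commutator)
      finally show False using quasi_invertibleI not_qi by (simp add: u_def)
    qed
  next
    fix y z assume "y \<in> I" "z \<in> I"
    then obtain c r d s where "r \<in> rann" "s \<in> rann" "y = c - c * u + r" "z = d - d * u + s"
      by (auto simp: I_def)
    then have "y + z = (c + d) - (c + d) * u + (r + s) \<and> r + s \<in> rann"
      by (simp add: distrib_right rann_add)
    then show "y + z \<in> I" unfolding I_def by blast
  next
    fix y k assume "y \<in> I"
    then obtain c r where "r \<in> rann" "y = c - c * u + r" by (auto simp: I_def)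
    then have "sm k y = sm k c - sm k c * u + sm k r \<and> sm k r \<in> rann"
      by (simp add: sm_add_right sm_diff_right sm_mult_left rann_def sm_mult_right)
    then show "sm k y \<in> I" unfolding I_def by blast
  next
    fix y b assume "y \<in> I"
    then obtain c r where "r \<in> rann" "y = c - c * u + r" by (auto simp: I_def)
    then have "b * y = b * c - (b * c) * u + 0 \<and> 0 \<in> (rann :: 'a set)"
      by (simp add: distrib_left right_diff_distrib mult.assoc rann_def)
    then show "b * y \<in> I" unfolding I_def by blast
  qed
  then obtain M where M: "proper_ideal sm e M" "I \<subseteq> M"
    "\<forall>J. proper_ideal sm e J \<longrightarrow> M \<subseteq> J \<longrightarrow> J = M"
    by (rule maximal_ideal_exists)
  obtain \<phi> where \<phi>: "character \<phi>" "\<And>x. x \<in> M \<Longrightarrow> \<phi> x = 0"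
    using character_of_maximal_ideal[OF M(1,3)] by blast
  have "e - e * u + 0 \<in> I" unfolding I_def using rann_0 by blast
  then have "\<phi> (e - e * u) = 0" using M(2) \<phi>(2) by auto
  then show False using x[OF \<phi>(1)] \<phi>(1) by (simp add: u_def)
qed

end

section \<open>Johnson's theorem on derivations\<close>

context right_unital_algebra
begin

lemma characters_distinguished:
  assumes "character \<phi>" "character \<psi>" "\<phi> \<noteq> \<psi>"
  obtains b where "\<phi> b = 0" "\<psi> b \<noteq> 0"
proof -
  obtain x where x: "\<phi> x \<noteq> \<psi> x" using assms by blast
  have "\<phi> (x - sm (\<phi> x) e) = 0" "\<psi> (x - sm (\<phi> x) e) \<noteq> 0"
    using x assms by auto
  then show ?thesis using that by blast
qed

lemma characters_interpolation:
  assumes "finite F" "\<And>\<psi>. \<psi> \<in> F \<Longrightarrow> character \<psi>" "character \<phi>" "\<phi> \<notin> F"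
  shows "\<exists>p. \<phi> p \<noteq> 0 \<and> (\<forall>\<psi>\<in>F. \<psi> p = 0)"
  using assms
proof (induction F)
  case empty
  then show ?case by (intro exI[of _ e]) simp
next
  case (insert \<psi> F)
  then obtain p where p: "\<phi> p \<noteq> 0" "\<forall>\<theta>\<in>F. \<theta> p = 0" by auto
  obtain b where b: "\<psi> b = 0" "\<phi> b \<noteq> 0"
    using characters_distinguished[of \<psi> \<phi>] insert.prems by auto
  have "\<phi> (p * b) \<noteq> 0" using p b insert.prems by simp
  moreover have "\<theta> (p * b) = 0" if "\<theta> \<in> insert \<psi> F" for \<theta>
    using that p b insert.prems by auto
  ultimately show ?case by blast
qed

text \<open>This supplies one step of the gliding hump. An element \<open>b\<close> with
  \<open>\<phi> b = 0\<close> and \<open>\<psi> b \<noteq> 0\<close> and its translate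
  \<open>b - sm (\<psi> b) e\<close> never vanish at the same character, so one of them is nonzero
  at infinitely many members of \<open>F\<close>.\<close>

lemma infinite_characters_split:
  assumes "infinite F" "\<And>\<psi>. \<psi> \<in> F \<Longrightarrow> character \<psi>"
  shows "\<exists>\<phi>\<in>F. \<exists>b. \<phi> b = 0 \<and> norm b \<le> 1 \<and> infinite {\<theta> \<in> F. \<theta> b \<noteq> 0}"
proof -
  have normalise: ?thesis if "\<phi> \<in> F" "\<phi> b = 0" "infinite {\<theta> \<in> F. \<theta> b \<noteq> 0}" for \<phi> b
  proof -
    define c where "c = (1 / (1 + norm b)) *\<^sub>R b"
    have pos: "1 + norm b > 0" by (simp add: add_pos_nonneg)
    have ch: "\<theta> c = of_real (1 / (1 + norm b)) * \<theta> b" if "\<theta> \<in> F" for \<theta>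
      unfolding c_def using assms(2)[OF that] by (rule character_scaleR)
    have "norm c \<le> 1" using pos by (simp add: c_def)
    moreover have "\<phi> c = 0" using ch[OF that(1)] that(2) by simp
    moreover have nz: "complex_of_real (1 / (1 + norm b)) \<noteq> 0"
      using pos by (simp only: of_real_eq_0_iff) simp
    have "\<theta> c \<noteq> 0 \<longleftrightarrow> \<theta> b \<noteq> 0" if "\<theta> \<in> F" for \<theta>
      unfolding ch[OF that] using nz by (simp only: mult_eq_0_iff) simp
    then have "{\<theta> \<in> F. \<theta> c \<noteq> 0} = {\<theta> \<in> F. \<theta> b \<noteq> 0}" by (intro Collect_cong conj_cong refl)
    ultimately show ?thesis using that by (intro bexI[of _ \<phi>] exI[of _ c] conjI) simp_all
  qed
  obtain \<phi> where \<phi>: "\<phi> \<in> F" using assms(1) by (metis finite.emptyI ex_in_conv)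
  have "infinite (F - {\<phi>})" using assms(1) by simp
  then obtain \<psi> where \<psi>: "\<psi> \<in> F" "\<psi> \<noteq> \<phi>" by (metis finite.emptyI ex_in_conv Diff_iff insertI1)
  obtain b where b: "\<phi> b = 0" "\<psi> b \<noteq> 0"
    using characters_distinguished[of \<phi> \<psi>] \<phi> \<psi> assms(2) by metis
  show ?thesis
  proof (cases "infinite {\<theta> \<in> F. \<theta> b \<noteq> 0}")
    case True
    then show ?thesis using normalise \<phi> b by blast
  next
    case False
    define c where "c = b - sm (\<psi> b) e"
    have "\<psi> c = 0" using assms(2)[OF \<psi>(1)] by (simp add: c_def)
    moreover have "F \<subseteq> {\<theta> \<in> F. \<theta> b \<noteq> 0} \<union> {\<theta> \<in> F. \<theta> c \<noteq> 0}"
      using b assms(2) by (auto simp: c_def)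
    then have "infinite {\<theta> \<in> F. \<theta> c \<noteq> 0}" using False assms(1) by (meson finite_UnI finite_subset)
    ultimately show ?thesis using normalise \<psi> by blast
  qed
qed

end

text \<open>\<open>separating\<close> expresses semisimplicity modulo \<open>rann\<close>.
  \<open>left_id_D\<close> keeps the values of \<open>D\<close> in e A, which meets
  \<open>rann\<close> only in 0, so these values are determined by the characters.\<close>

locale derivation_on_algebra = right_unital_algebra +
  fixes D
  assumes derivation: "derivation sm D"
    and left_id_D: "e * D x = D x"
    and separating: "(\<And>\<phi>. character \<phi> \<Longrightarrow> \<phi> x = 0) \<Longrightarrow> x \<in> rann"
begin

lemma D_add: "D (x + y) = D x + D y"
  and D_sm: "D (sm c x) = sm c (D x)"
  and D_mult: "D (x * y) = D x * y + x * D y"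
  using derivation by (auto simp: derivation_def clinear_map_def)

lemma D_scaleR: "D (r *\<^sub>R x) = r *\<^sub>R D x"
  using D_sm[of "of_real r" x] by (simp add: sm_of_real)

lemma linear_D: "linear D"
  by (intro linearI D_add D_scaleR)

lemma D_0 [simp]: "D 0 = 0"
  using linear_0[OF linear_D] .

lemma D_diff: "D (x - y) = D x - D y"
  using linear_diff[OF linear_D] .

lemma D_rann: assumes "r \<in> rann" shows "D r = 0"
proof -
  have "a * D r = 0" for a
    using D_mult[of a r] assms by (simp add: rann_def)
  then show ?thesis using left_id_D[of r] by simp
qed

lemma D_eq_if_characters_eq: "D x = D y" if "\<And>\<phi>. character \<phi> \<Longrightarrow> \<phi> x = \<phi> y"
proof -
  have "x - y \<in> rann" by (rule separating) (simp add: that)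
  then show ?thesis using D_rann D_diff[of x y] by simp
qed

text \<open>Here \<open>w\<close> plays the role of the characteristic function of the isolated point \<open>\<phi>\<close> of the
  character space.\<close>

lemma point_derivation_isolated:
  assumes \<phi>: "character \<phi>" and w: "\<phi> w = 1" "\<And>\<psi>. character \<psi> \<Longrightarrow> \<psi> \<noteq> \<phi> \<Longrightarrow> \<psi> w = 0"
  shows "\<phi> (D x) = 0"
proof -
  \<comment> \<open>Both arguments agree at every character; in the resulting equation the terms
    with \<open>\<phi> (D w)\<close> cancel.\<close>
  have "D (w * x) = D (sm (\<phi> x) w)"
  proof (rule D_eq_if_characters_eq)
    fix \<theta> assume \<theta>: "character \<theta>"
    show "\<theta> (w * x) = \<theta> (sm (\<phi> x) w)"
      using \<theta> w by (cases "\<theta> = \<phi>") auto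
  qed
  then have "\<phi> (D w * x + w * D x) = \<phi> (sm (\<phi> x) (D w))" by (simp add: D_mult D_sm)
  then show ?thesis using \<phi> w by (simp add: mult.commute)
qed

section \<open>Characters whose point derivation is discontinuous\<close>

definition unbounded_chars where
  "unbounded_chars = {\<phi>. character \<phi> \<and> \<not> (\<exists>K. \<forall>x. cmod (\<phi> (D x)) \<le> K * norm x)}"

text \<open>This selects the next term of the gliding hump: on a small ball
  \<open>\<phi> (D y)\<close> is unbounded while the other terms stay bounded.\<close>

lemma unbounded_char_large_value:
  assumes \<phi>: "\<phi> \<in> unbounded_chars" and "\<beta> \<noteq> 0" "\<delta> > 0"
  shows "\<exists>y. norm y \<le> \<delta> \<and> B \<le> cmod (\<alpha> + \<beta> * \<phi> (D y) + \<gamma> * \<phi> y)"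
proof -
  have ch: "character \<phi>" and unb: "\<not> (\<exists>K. \<forall>x. cmod (\<phi> (D x)) \<le> K * norm x)"
    using \<phi> by (auto simp: unbounded_chars_def)
  \<comment> \<open>\<open>K\<close> solves \<open>cmod \<beta> * \<delta> * K = B + cmod \<alpha> +
    cmod \<gamma> * \<delta>\<close>, the bound wanted once the vector is scaled to norm
    \<open>\<delta>\<close>.\<close>
  define K where "K = (B + cmod \<alpha> + cmod \<gamma> * \<delta>) / (cmod \<beta> * \<delta>)"
  obtain v where v: "cmod (\<phi> (D v)) > K * norm v" using unb by (metis not_le)
  then have "v \<noteq> 0" using ch by auto
  define y where "y = (\<delta> / norm v) *\<^sub>R v"
  have ny: "norm y = \<delta>" using \<open>v \<noteq> 0\<close> \<open>\<delta> > 0\<close> by (simp add: y_def)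
  have "cmod (\<phi> (D y)) = \<delta> / norm v * cmod (\<phi> (D v))"
    using ch \<open>\<delta> > 0\<close> by (simp add: y_def D_scaleR norm_mult norm_divide)
  also have "\<dots> \<ge> \<delta> / norm v * (K * norm v)"
    using v \<open>\<delta> > 0\<close> by (intro mult_left_mono) auto
  finally have "cmod \<beta> * (\<delta> * K) \<le> cmod \<beta> * cmod (\<phi> (D y))"
    using \<open>v \<noteq> 0\<close> by (intro mult_left_mono) auto
  then have "B + cmod \<alpha> + cmod \<gamma> * \<delta> \<le> cmod (\<beta> * \<phi> (D y))"
    using assms by (simp add: K_def norm_mult)
  moreover have "cmod (\<gamma> * \<phi> y) \<le> cmod \<gamma> * \<delta>"
    using norm_character_le[OF ch, of y] by (simp add: norm_mult ny mult_left_mono)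
  moreover have "cmod (\<beta> * \<phi> (D y)) \<le> cmod (\<alpha> + \<beta> * \<phi> (D y) + \<gamma> * \<phi> y) + cmod \<alpha> + cmod (\<gamma> * \<phi> y)"
    using norm_triangle_ineq4[of "\<alpha> + \<beta> * \<phi> (D y) + \<gamma> * \<phi> y" "\<alpha> + \<gamma> * \<phi> y"]
      norm_triangle_ineq[of \<alpha> "\<gamma> * \<phi> y"] by simp
  ultimately show ?thesis using ny by (intro exI[of _ y]) linarith
qed

text \<open>The factor \<open>b\<close> is squared so that everything vanishes when
  \<open>\<phi> b = 0\<close>; a single factor would leave
  \<open>\<phi> (D b) * \<phi> z\<close>.\<close>

lemma point_derivation_square_mult:
  assumes "character \<phi>"
  shows "\<phi> (D (b * (b * z))) = \<phi> b * \<phi> b * \<phi> (D z) + 2 * \<phi> b * \<phi> (D b) * \<phi> z"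
  using assms by (simp add: D_mult algebra_simps)

text \<open>A gliding hump: with \<open>\<phi>\<^sub>n b\<^sub>n = 0\<close> and \<open>\<phi>\<^sub>k b\<^sub>n \<noteq> 0\<close> for \<open>k > n\<close>, put
  \<open>x = y\<^sub>0 + b\<^sub>0\<^sup>2 (y\<^sub>1 + b\<^sub>1\<^sup>2 (y\<^sub>2 + \<dots>))\<close>. As \<open>\<phi>\<^sub>n \<circ> D\<close> vanishes on \<open>b\<^sub>n\<^sup>2 A\<close>, the number
  \<open>\<phi>\<^sub>n (D x)\<close> depends on \<open>y\<^sub>0, \<dots>, y\<^sub>n\<close> only, and a small \<open>y\<^sub>n\<close> makes it exceed \<open>n\<close>.\<close>

lemma finite_unbounded_chars: "finite unbounded_chars"
proof (rule ccontr)
  assume inf: "infinite unbounded_chars"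
  have "\<forall>F. \<exists>\<phi> b. infinite F \<and> (\<forall>\<psi>\<in>F. character \<psi>) \<longrightarrow>
      \<phi> \<in> F \<and> \<phi> b = 0 \<and> norm b \<le> 1 \<and> infinite {\<theta> \<in> F. \<theta> b \<noteq> 0}"
  proof
    fix F :: "('a \<Rightarrow> complex) set"
    show "\<exists>\<phi> b. infinite F \<and> (\<forall>\<psi>\<in>F. character \<psi>) \<longrightarrow>
      \<phi> \<in> F \<and> \<phi> b = 0 \<and> norm b \<le> 1 \<and> infinite {\<theta> \<in> F. \<theta> b \<noteq> 0}"
    proof (cases "infinite F \<and> (\<forall>\<psi>\<in>F. character \<psi>)")
      case True
      then have "\<exists>\<phi>\<in>F. \<exists>b. \<phi> b = 0 \<and> norm b \<le> 1 \<and> infinite {\<theta> \<in> F. \<theta> b \<noteq> 0}"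
        by (intro infinite_characters_split) simp_all
      then show ?thesis by blast
    qed (intro exI impI, simp only: simp_thms)
  qed
  then obtain p\<phi> pb where split: "\<forall>F. infinite F \<and> (\<forall>\<psi>\<in>F. character \<psi>) \<longrightarrow>
      p\<phi> F \<in> F \<and> p\<phi> F (pb F) = 0 \<and> norm (pb F) \<le> 1 \<and> infinite {\<theta> \<in> F. \<theta> (pb F) \<noteq> 0}"
    unfolding choice_iff by blast
  \<comment> \<open>\<open>Fs n\<close> consists of the exceptional characters that are nonzero at
    the first \<open>n\<close> chosen elements; it stays infinite.\<close>
  define Fs where "Fs n = ((\<lambda>F. {\<theta> \<in> F. \<theta> (pb F) \<noteq> 0}) ^^ n) unbounded_chars" for n
  have Fs_Suc: "Fs (Suc n) = {\<theta> \<in> Fs n. \<theta> (pb (Fs n)) \<noteq> 0}" for n by (simp add: Fs_def)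
  have Fs: "infinite (Fs n) \<and> Fs n \<subseteq> unbounded_chars" for n
  proof (induction n)
    case 0
    then show ?case using inf by (simp add: Fs_def)
  next
    case (Suc n)
    then have "infinite {\<theta> \<in> Fs n. \<theta> (pb (Fs n)) \<noteq> 0}"
      using split[rule_format, of "Fs n"] by (auto simp: unbounded_chars_def)
    then show ?case using Suc by (auto simp: Fs_Suc)
  qed
  define \<phi> where "\<phi> n = p\<phi> (Fs n)" for n
  define b where "b n = pb (Fs n)" for n
  have split': "\<phi> n \<in> Fs n \<and> \<phi> n (b n) = 0 \<and> norm (b n) \<le> 1" for n
    unfolding \<phi>_def b_def using split[rule_format, of "Fs n"] Fs[of n] by (auto simp: unbounded_chars_def)
  then have \<phi>_unb: "\<phi> n \<in> unbounded_chars" for n using Fs by blast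
  then have \<phi>_char: "character (\<phi> n)" for n by (auto simp: unbounded_chars_def)
  have Fs_anti: "Fs k \<subseteq> Fs n" if "n \<le> k" for n k
    using that by (induction rule: dec_induct) (auto simp: Fs_Suc)
  have nonzero: "\<phi> k (b n) \<noteq> 0" if "n < k" for n k
    using split'[of k] Fs_anti[of "Suc n" k] that by (auto simp: Fs_Suc b_def)
  define L where "L n z = b n * (b n * z)" for n z
  have norm_L: "norm (L n z) \<le> norm z" for n z
  proof -
    have "norm (b n * x) \<le> norm x" for x
      using norm_mult_ineq[of "b n" x] split'[of n] mult_right_mono[of "norm (b n)" 1 "norm x"] by simp
    then show ?thesis unfolding L_def by (meson order_trans)
  qed
  have L_bl: "bounded_linear (L n)" for n
    unfolding L_def
    by (intro bounded_linear_compose[OF bounded_linear_mult_right bounded_linear_mult_right])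
  \<comment> \<open>\<open>S\<close> completes the first \<open>n\<close> terms of the nested sum by
    a tail \<open>w\<close>. \<open>P\<close> says that a character nonzero at the earlier
    \<open>b k\<close> still sees \<open>D w\<close> with a nonzero coefficient; \<open>Q\<close>
    adds a term that makes the value at \<open>\<phi> n\<close> large for every tail.\<close>
  define P where "P n S \<longleftrightarrow> (\<forall>\<theta>. character \<theta> \<longrightarrow> (\<forall>k<n. \<theta> (b k) \<noteq> 0) \<longrightarrow>
      (\<exists>\<alpha> \<beta> \<gamma>. \<beta> \<noteq> 0 \<and> (\<forall>w. \<theta> (D (S w)) = \<alpha> + \<beta> * \<theta> (D w) + \<gamma> * \<theta> w)))" for n S
  define Q where "Q n S S' \<longleftrightarrow> (\<exists>y. norm y \<le> (1/2)^n \<and> S' = (\<lambda>z. S (y + L n z)) \<and>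
      (\<forall>z. real n \<le> cmod (\<phi> n (D (S' z)))))" for n S S'
  have "\<exists>S. \<forall>n. (P n (S n) \<and> (n = 0 \<longrightarrow> S n = id)) \<and> Q n (S n) (S (Suc n))"
  proof (rule dependent_nat_choice)
    show "\<exists>S. P 0 S \<and> (0 = (0::nat) \<longrightarrow> S = id)"
    proof -
      have "(1::complex) \<noteq> 0 \<and> (\<forall>w. \<theta> (D (id w)) = 0 + 1 * \<theta> (D w) + 0 * \<theta> w)"
        for \<theta> :: "'a \<Rightarrow> complex" by simp
      then have "P 0 id" unfolding P_def by blast
      then show ?thesis by simp
    qed
  next
    fix S n assume "P n S \<and> (n = 0 \<longrightarrow> S = id)"
    then have P: "P n S" by simp
    then obtain \<alpha> \<beta> \<gamma> where \<beta>: "\<beta> \<noteq> 0"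
      and S: "\<And>w. \<phi> n (D (S w)) = \<alpha> + \<beta> * \<phi> n (D w) + \<gamma> * \<phi> n w"
      unfolding P_def using \<phi>_char nonzero by metis
    obtain y where y: "norm y \<le> (1/2)^n" "real n \<le> cmod (\<alpha> + \<beta> * \<phi> n (D y) + \<gamma> * \<phi> n y)"
      using unbounded_char_large_value[OF \<phi>_unb \<beta>, of "(1/2)^n"] by fastforce
    define S' where "S' = (\<lambda>z. S (y + L n z))"
    have "\<phi> n (D (S' z)) = \<alpha> + \<beta> * \<phi> n (D y) + \<gamma> * \<phi> n y" for z
      using point_derivation_square_mult[OF \<phi>_char, of n "b n" z] split'[of n]
      by (simp add: S'_def S D_add \<phi>_char L_def)
    then have "Q n S S'" unfolding Q_def using y S'_def by auto
    moreover have "P (Suc n) S'"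
      unfolding P_def
    proof (intro allI impI)
      fix \<theta> assume \<theta>: "character \<theta>" "\<forall>k<Suc n. \<theta> (b k) \<noteq> 0"
      then obtain \<alpha> \<beta> \<gamma> where \<beta>: "\<beta> \<noteq> 0"
        and S: "\<And>w. \<theta> (D (S w)) = \<alpha> + \<beta> * \<theta> (D w) + \<gamma> * \<theta> w"
        using P unfolding P_def by (metis less_Suc_eq)
      have "\<theta> (D (S' w)) = (\<alpha> + \<beta> * \<theta> (D y) + \<gamma> * \<theta> y) + (\<beta> * \<theta> (b n) * \<theta> (b n)) * \<theta> (D w)
        + (\<beta> * 2 * \<theta> (b n) * \<theta> (D (b n)) + \<gamma> * \<theta> (b n) * \<theta> (b n)) * \<theta> w" for w
        using point_derivation_square_mult[OF \<theta>(1), of "b n" w] \<theta>(1)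
        by (simp add: S'_def S D_add L_def algebra_simps)
      moreover have "\<beta> * \<theta> (b n) * \<theta> (b n) \<noteq> 0" using \<beta> \<theta>(2) by simp
      ultimately show "\<exists>\<alpha> \<beta> \<gamma>. \<beta> \<noteq> 0 \<and> (\<forall>w. \<theta> (D (S' w)) = \<alpha> + \<beta> * \<theta> (D w) + \<gamma> * \<theta> w)"
        by blast
    qed
    ultimately show "\<exists>S'. (P (Suc n) S' \<and> (Suc n = 0 \<longrightarrow> S' = id)) \<and> Q n S S'" by blast
  qed
  then obtain S where S0: "S 0 = id" and SQ: "\<And>n. Q n (S n) (S (Suc n))" by blast
  obtain y where y: "\<And>n. norm (y n) \<le> (1/2)^n"
    and S_Suc: "\<And>n. S (Suc n) = (\<lambda>z. S n (y n + L n z))"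
    and large: "\<And>n z. real n \<le> cmod (\<phi> n (D (S (Suc n) z)))"
  proof -
    have "\<forall>n. \<exists>y. norm y \<le> (1/2)^n \<and> S (Suc n) = (\<lambda>z. S n (y + L n z)) \<and>
        (\<forall>z. real n \<le> cmod (\<phi> n (D (S (Suc n) z))))"
      using SQ unfolding Q_def by blast
    then show ?thesis using that unfolding choice_iff by blast
  qed
  \<comment> \<open>\<open>u j n\<close> is \<open>L n (L (n + 1) (... (y (n + j))))\<close>, the
    \<open>j\<close>-th term of the tail \<open>T n\<close> of the nested sum.\<close>
  define u where "u = rec_nat y (\<lambda>_ v n. L n (v (Suc n)))"
  have u_0: "u 0 n = y n" and u_Suc: "u (Suc j) n = L n (u j (Suc n))" for j n
    by (simp_all add: u_def)
  have u_le: "norm (u j n) \<le> (1/2)^(n + j)" for j n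
  proof (induction j arbitrary: n)
    case (Suc j)
    then show ?case using order_trans[OF norm_L Suc[of "Suc n"]] by (simp add: u_Suc)
  qed (simp add: u_0 y)
  have u_summable: "summable (\<lambda>j. u j n)" for n
  proof (rule summable_comparison_test)
    show "\<exists>N. \<forall>j\<ge>N. norm (u j n) \<le> (1/2)^n * (1/2)^j" using u_le by (simp add: power_add)
    show "summable (\<lambda>j. (1/2)^n * (1/2::real)^j)" by (intro summable_mult summable_geometric) simp
  qed
  define T where "T n = (\<Sum>j. u j n)" for n
  have T: "T n = y n + L n (T (Suc n))" for n
    using suminf_split_head[OF u_summable, of n] bounded_linear.suminf[OF L_bl u_summable, of n "Suc n"]
    by (simp add: T_def u_0 u_Suc)
  \<comment> \<open>Each \<open>S n\<close> rebuilds the same element \<open>T 0\<close> from its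
    tail, so \<open>large\<close> applies to \<open>D (T 0)\<close> for all \<open>n\<close> at
    once.\<close>
  have ST: "S n (T n) = T 0" for n
  proof (induction n)
    case (Suc n)
    then show ?case using T[of n] by (simp add: S_Suc)
  qed (simp add: S0)
  obtain n :: nat where "real n > norm (D (T 0))" using reals_Archimedean2 by blast
  moreover have "real n \<le> cmod (\<phi> n (D (T 0)))" using large[of n "T (Suc n)"] ST[of "Suc n"] by simp
  ultimately show False using norm_character_le[OF \<phi>_char, of n "D (T 0)"] by linarith
qed

lemma bounded_linear_D: "bounded_linear D"
proof (rule closed_graph_bounded_linear[OF linear_D])
  fix X y assume X: "X \<longlonglongrightarrow> 0" and y: "(\<lambda>n. D (X n)) \<longlonglongrightarrow> y"
  have cont: "(\<lambda>n. \<phi> (D (X n))) \<longlonglongrightarrow> \<phi> y" if "character \<phi>" for \<phi>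
  proof -
    have "bounded_linear \<phi>"
      by (rule bounded_linear_intro[of _ 1])
        (use that norm_character_le[OF that] in \<open>auto simp: scaleR_conv_of_real\<close>)
    then show ?thesis using y by (rule bounded_linear.tendsto)
  qed
  have bounded_zero: "\<psi> y = 0" if \<psi>: "character \<psi>" "\<psi> \<notin> unbounded_chars" for \<psi>
  proof -
    obtain K where K: "\<And>x. cmod (\<psi> (D x)) \<le> K * norm x"
      using \<psi> by (auto simp: unbounded_chars_def)
    have "(\<lambda>n. \<psi> (D (X n))) \<longlonglongrightarrow> 0"
    proof (rule Lim_null_comparison)
      show "\<forall>\<^sub>F n in sequentially. norm (\<psi> (D (X n))) \<le> K * norm (X n)"
        by (intro always_eventually allI K)
      show "(\<lambda>n. K * norm (X n)) \<longlonglongrightarrow> 0"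
        using tendsto_mult_right_zero[OF tendsto_norm_zero[OF X]] .
    qed
    then show ?thesis using LIMSEQ_unique cont[OF \<psi>(1)] by blast
  qed
  have "\<phi> y = 0" if \<phi>: "character \<phi>" for \<phi>
  proof (rule ccontr)
    assume ne: "\<phi> y \<noteq> 0"
    then have unb: "\<phi> \<in> unbounded_chars" using bounded_zero[OF \<phi>] by blast
    have "\<exists>p. \<phi> p \<noteq> 0 \<and> (\<forall>\<psi>\<in>unbounded_chars - {\<phi>}. \<psi> p = 0)"
      by (rule characters_interpolation)
        (use \<phi> finite_unbounded_chars in \<open>auto simp: unbounded_chars_def\<close>)
    then obtain p where p: "\<phi> p \<noteq> 0" "\<forall>\<psi>\<in>unbounded_chars - {\<phi>}. \<psi> p = 0" by blast
    \<comment> \<open>The factor \<open>y\<close> vanishes at the characters outside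
      \<open>unbounded_chars\<close>, and \<open>p\<close> at the exceptional ones other than
      \<open>\<phi>\<close>, so \<open>w\<close> isolates \<open>\<phi>\<close>.\<close>
    define w where "w = sm (1 / (\<phi> y * \<phi> p)) (y * p)"
    have "\<phi> (D x) = 0" for x
    proof (rule point_derivation_isolated[OF \<phi>])
      show "\<phi> w = 1" using \<phi> ne p by (simp add: w_def)
      show "\<psi> w = 0" if "character \<psi>" "\<psi> \<noteq> \<phi>" for \<psi>
        using that p bounded_zero[of \<psi>] by (cases "\<psi> \<in> unbounded_chars") (auto simp: w_def)
    qed
    then have "\<forall>x. cmod (\<phi> (D x)) \<le> 0 * norm x" by simp
    then show False using unb unfolding unbounded_chars_def by blast
  qed
  then have "y \<in> rann" by (rule separating)
  \<comment> \<open>Left multiplication by \<open>e\<close> fixes every \<open>D (X n)\<close>,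
    hence also the limit.\<close>
  moreover have "(\<lambda>n. D (X n)) \<longlonglongrightarrow> e * y"
    using tendsto_mult_left[OF y, of e] unfolding left_id_D .
  then have "e * y = y" using y by (rule LIMSEQ_unique)
  ultimately show "y = 0" by (rule rann_fixed_zero)
qed

text \<open>Every other term of the Leibniz expansion carries a derivative of \<open>u\<close> of
  order below \<open>j\<close>.\<close>

lemma character_derivative_mult:
  assumes "character \<phi>" "\<And>i. i < j \<Longrightarrow> \<phi> ((D ^^ i) u) = 0"
  shows "\<phi> ((D ^^ j) (v * u)) = \<phi> v * \<phi> ((D ^^ j) u)"
  using assms(2)
proof (induction j arbitrary: u v)
  case 0
  then show ?case using assms(1) by simp
next
  case (Suc j)
  have add: "(D ^^ j) (x + y) = (D ^^ j) x + (D ^^ j) y" for x y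
    by (induction j) (auto simp: D_add)
  have "\<phi> ((D ^^ j) (D v * u)) = 0" using Suc.IH[of u "D v"] Suc.prems by simp
  moreover have "\<phi> ((D ^^ j) (v * D u)) = \<phi> v * \<phi> ((D ^^ j) (D u))"
  proof (rule Suc.IH)
    fix i assume "i < j"
    then show "\<phi> ((D ^^ i) (D u)) = 0" using Suc.prems[of "Suc i"] by (simp add: funpow_swap1)
  qed
  ultimately show ?case
    using assms(1) by (simp add: funpow_swap1 D_mult add)
qed

text \<open>In the Leibniz expansion, terms with fewer than \<open>j\<close> derivatives on
  \<open>u\<close> vanish by assumption, and the one with \<open>j + 1\<close> has the factor
  \<open>\<phi> a = 0\<close>. The remaining term has binomial coefficient
  \<open>Suc j\<close>.\<close>

lemma character_derivative_mult_kernel: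
  assumes "character \<phi>" "\<phi> a = 0" "\<And>i. i < j \<Longrightarrow> \<phi> ((D ^^ i) u) = 0"
  shows "\<phi> ((D ^^ Suc j) (a * u)) = of_nat (Suc j) * \<phi> (D a) * \<phi> ((D ^^ j) u)"
  using assms(3)
proof (induction j arbitrary: u)
  case 0
  then show ?case using assms(1,2) by (simp add: D_mult)
next
  case (Suc j)
  have add: "(D ^^ n) (x + y) = (D ^^ n) x + (D ^^ n) y" for n x y
    by (induction n) (auto simp: D_add)
  have "\<phi> ((D ^^ Suc j) (a * D u)) = of_nat (Suc j) * \<phi> (D a) * \<phi> ((D ^^ j) (D u))"
  proof (rule Suc.IH)
    fix i assume "i < j"
    then show "\<phi> ((D ^^ i) (D u)) = 0" using Suc.prems[of "Suc i"] by (simp add: funpow_swap1)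
  qed
  moreover have "\<phi> ((D ^^ Suc j) (D a * u)) = \<phi> (D a) * \<phi> ((D ^^ Suc j) u)"
    using Suc.prems by (intro character_derivative_mult assms(1)) auto
  moreover have "(D ^^ Suc (Suc j)) (a * u) = (D ^^ Suc j) (D a * u) + (D ^^ Suc j) (a * D u)"
    by (simp only: funpow_Suc_right[of "Suc j"] o_apply D_mult add)
  moreover have "(D ^^ j) (D u) = (D ^^ Suc j) u" by (simp add: funpow_swap1)
  ultimately show ?case
    using assms(1) by (simp only: character_add) (simp add: algebra_simps)
qed

lemma character_D_kernel:
  assumes \<phi>: "character \<phi>" and a: "\<phi> a = 0"
  shows "\<phi> (D a) = 0"
proof (rule ccontr)
  assume ne: "\<phi> (D a) \<noteq> 0"
  \<comment> \<open>A substitute for the powers of \<open>a\<close> in the absence of a unit, with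
    \<open>p 0 = e\<close>.\<close>
  define p where "p n = ((*) a ^^ n) e" for n
  have vanish: "\<forall>i<n. \<phi> ((D ^^ i) (p n)) = 0" for n
  proof (induction n)
    case (Suc n)
    show ?case
    proof (intro allI impI)
      fix i assume "i < Suc n"
      then show "\<phi> ((D ^^ i) (p (Suc n))) = 0"
        using character_derivative_mult[OF \<phi>, of i "p n" a] Suc a by (simp add: p_def)
    qed
  qed simp
  have fact: "\<phi> ((D ^^ n) (p n)) = fact n * \<phi> (D a) ^ n" for n
  proof (induction n)
    case (Suc n)
    then show ?case
      using character_derivative_mult_kernel[OF \<phi> a, of n "p n"] vanish[of n] by (simp add: p_def)
  qed (use \<phi> in \<open>simp add: p_def\<close>)
  obtain K where K: "K > 0" "\<And>x. norm (D x) \<le> norm x * K"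
    using bounded_linear.pos_bounded[OF bounded_linear_D] by blast
  have iterate: "norm ((D ^^ n) x) \<le> K ^ n * norm x" for n x
  proof (induction n)
    case (Suc n)
    have "norm ((D ^^ Suc n) x) \<le> norm ((D ^^ n) x) * K" using K by simp
    also have "\<dots> \<le> K ^ n * norm x * K" using Suc K by (intro mult_right_mono) auto
    finally show ?case by (simp add: mult_ac)
  qed simp
  have norm_p: "norm (p n) \<le> norm a ^ n * norm e" for n
  proof (induction n)
    case (Suc n)
    have "norm (p (Suc n)) \<le> norm a * norm (p n)" by (simp add: p_def norm_mult_ineq)
    also have "\<dots> \<le> norm a * (norm a ^ n * norm e)" using Suc by (intro mult_left_mono) auto
    finally show ?case by (simp add: mult_ac)
  qed (simp add: p_def)
  \<comment> \<open>Comparing the factorial identity with the geometric bound keeps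
    \<open>norm e * (t ^ n / fact n)\<close> above 1, although it tends to 0.\<close>
  define t where "t = K * norm a / cmod (\<phi> (D a))"
  have "1 \<le> norm e * (t ^ n / fact n)" for n
  proof -
    have "fact n * cmod (\<phi> (D a)) ^ n = cmod (\<phi> ((D ^^ n) (p n)))"
      by (simp add: fact norm_mult norm_power)
    also have "\<dots> \<le> norm ((D ^^ n) (p n))" by (rule norm_character_le[OF \<phi>])
    also have "\<dots> \<le> K ^ n * (norm a ^ n * norm e)"
      using iterate[of n "p n"] norm_p[of n] K by (meson mult_left_mono order_trans zero_le_power less_imp_le)
    finally show ?thesis
      using ne by (simp add: t_def power_divide power_mult_distrib field_simps)
  qed
  moreover have "(\<lambda>n. norm e * (t ^ n / fact n)) \<longlonglongrightarrow> norm e * 0"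
    using summable_LIMSEQ_zero[OF summable_exp[of t]]
    by (intro tendsto_mult tendsto_const) (simp add: divide_inverse mult.commute)
  ultimately have "1 \<le> norm e * 0" by (intro tendsto_lowerbound[where F = sequentially]) auto
  then show False by simp
qed

text \<open>Subtracting \<open>sm (\<phi> x) e\<close> moves \<open>x\<close> into the kernel of
  \<open>\<phi>\<close>, and idempotence of \<open>e\<close> gives
  \<open>\<phi> (D e) = 0\<close>.\<close>

theorem D_eq_0: "D x = 0"
proof -
  have "\<phi> (D x) = 0" if \<phi>: "character \<phi>" for \<phi>
  proof -
    have "\<phi> (D (x - sm (\<phi> x) e)) = 0" by (rule character_D_kernel[OF \<phi>]) (simp add: \<phi>)
    moreover have "\<phi> (D (e * e)) = \<phi> (D e) + \<phi> (D e)" by (simp only: D_mult) (simp add: \<phi>)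
    then have "\<phi> (D e) = 0" by simp
    ultimately show ?thesis by (simp add: D_diff D_sm \<phi>)
  qed
  then have "D x \<in> rann" by (rule separating)
  then show ?thesis using left_id_D by (rule rann_fixed_zero)
qed

end

section \<open>Centralizing generalized derivations\<close>

text \<open>This turns centralizing into commuting when commutators lie in
  \<open>rann\<close>.\<close>

lemma center_Int_rann:
  fixes e z :: "'a::ring"
  assumes "\<And>a :: 'a. a * e = a" "z \<in> center" "z \<in> rann"
  shows "z = 0"
proof -
  have "z = z * e" using assms(1) by simp
  also have "\<dots> = e * z" using assms(2) by (simp add: center_def)
  finally show ?thesis using assms(3) by (simp add: rann_def)
qed

section \<open>Right multiplications as centralizing generalized derivations\<close>

context right_unital_algebra
begin

text \<open>The associated derivation is 0, and the map is even commuting, as \<open>a\<close>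
  annihilates the commutator of \<open>x\<close> and \<open>a\<close>.\<close>

lemma right_mult_in_CGD: "(\<lambda>a. a * x) \<in> CGD sm"
proof -
  have "derivation sm (\<lambda>_. 0)" by (simp add: derivation_def clinear_map_def)
  moreover have "clinear_map sm (\<lambda>a. a * x)"
    by (simp add: clinear_map_def distrib_right sm_mult_left)
  ultimately have "generalized_derivation sm (\<lambda>a. a * x)"
    unfolding generalized_derivation_def by (auto simp: mult.assoc intro!: exI[of _ "\<lambda>_. 0"])
  moreover have "a * x * a - a * (a * x) = 0" for a
  proof -
    have "a * (x * a - a * x) = 0" using commutator[of x a] by (simp add: rann_def)
    then show ?thesis by (simp add: right_diff_distrib mult.assoc)
  qed
  then have "centralizing (\<lambda>a. a * x)" by (simp add: centralizing_def center_def)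
  ultimately show ?thesis by (simp add: CGD_def)
qed

lemma CGD_right_mult:
  assumes rad: "(jrad :: 'a set) = rann" and \<delta>: "\<delta> \<in> CGD sm"
  shows "\<delta> a = a * \<delta> e"
proof -
  obtain d where d: "derivation sm d" and \<delta>_mult: "\<And>a b. \<delta> (a * b) = a * \<delta> b + d a * b"
    using \<delta> by (auto simp: CGD_def generalized_derivation_def)
  have \<delta>_eq: "\<delta> a = a * \<delta> e + d a" for a using \<delta>_mult[of a e] by simp
  have d_add: "d (x + y) = d x + d y" and d_mult: "d (x * y) = d x * y + x * d y" for x y
    using d by (auto simp: derivation_def clinear_map_def)
  have comm: "d a * a = a * d a" for a
  proof -
    have "\<delta> a * a - a * \<delta> a = 0"
      using \<delta> by (intro center_Int_rann[OF right_id] commutator) (auto simp: CGD_def centralizing_def)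
    \<comment> \<open>The terms with \<open>\<delta> e\<close> cancel because \<open>a\<close>
      annihilates the commutator of \<open>\<delta> e\<close> and \<open>a\<close>.\<close>
    then have "(a * \<delta> e + d a) * a = a * (a * \<delta> e + d a)" by (simp add: \<delta>_eq[of a])
    moreover have "a * (\<delta> e * a - a * \<delta> e) = 0"
      using commutator[of "\<delta> e" a] by (simp add: rann_def)
    ultimately show ?thesis by (simp add: distrib_left distrib_right right_diff_distrib mult.assoc)
  qed
  have kill: "a * d e = 0" for a using d_mult[of a e] by simp
  then have de: "d e = 0" using comm[of e] by simp
  \<comment> \<open>The commuting identity is linearized at \<open>a + e\<close>, where
    \<open>d (a + e) = d a\<close>.\<close>
  have left: "e * d a = d a" for a
    using comm[of "a + e"] comm[of a] by (simp add: d_add de distrib_left distrib_right)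
  interpret derivation_on_algebra sm e d
    by unfold_locales (use d left characters_separate_modulo_jrad rad in auto)
  show ?thesis using \<delta>_eq[of a] D_eq_0[of a] by simp
qed

end

text \<open>Both sides say that \<open>x - y\<close> lies in \<open>rann\<close>; thus cosets and
  right multiplications determine each other.\<close>

lemma rcoset_eq_iff:
  fixes x y :: "'a::ring"
  assumes rad: "(jrad :: 'a set) = rann"
  shows "rcoset x = rcoset y \<longleftrightarrow> (\<forall>a. a * x = a * y)"
proof
  assume "rcoset x = rcoset y"
  moreover have "x \<in> rcoset x" using rann_0 by (force simp: rcoset_def rad)
  ultimately obtain r where "x = y + r" "r \<in> rann" by (auto simp: rcoset_def rad)
  then show "\<forall>a. a * x = a * y" by (simp add: rann_def distrib_left)
next
  have sub: "rcoset x \<subseteq> rcoset y" if eq: "\<forall>a. a * x = a * y" for x y :: 'a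
  proof
    fix z assume "z \<in> rcoset x"
    then obtain r where "r \<in> rann" "z = x + r" by (auto simp: rcoset_def rad)
    then have "z = y + (x - y + r) \<and> x - y + r \<in> jrad"
      using eq by (simp add: rad rann_def distrib_left right_diff_distrib)
    then show "z \<in> rcoset y" unfolding rcoset_def by blast
  qed
  assume "\<forall>a. a * x = a * y"
  then show "rcoset x = rcoset y" using sub[of x y] sub[of y x] by simp
qed

theorem theorem4p9:
  fixes sm :: "complex \<Rightarrow> 'a::{real_normed_algebra,banach} \<Rightarrow> 'a"
  assumes "complex_banach_algebra sm"
    and "(jrad :: 'a set) = rann"
    and "\<forall>a b :: 'a. a * b - b * a \<in> jrad"
    and "\<exists>e :: 'a. \<forall>a. a * e = a"
  shows "CGD_iso_quotient sm"
proof -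
  obtain e :: 'a where e: "\<And>a. a * e = a" using assms(4) by blast
  interpret right_unital_algebra sm e
    by unfold_locales (use assms e in auto)
  note rad = assms(2)
  \<comment> \<open>Composing right multiplications reverses the order of the factors; this identity
    restores it.\<close>
  have comm3: "a * x * y = a * y * x" for a x y :: 'a
  proof -
    have "a * (x * y - y * x) = 0" using commutator[of x y] by (simp add: rann_def)
    then show ?thesis by (simp add: right_diff_distrib mult.assoc)
  qed
  have form: "\<exists>x. \<delta> = (\<lambda>a. a * x)" if "\<delta> \<in> CGD sm" for \<delta>
    using CGD_right_mult[OF rad that] by blast
  \<comment> \<open>For right multiplication by \<open>x\<close>, the value at \<open>e\<close> is
    \<open>e * x\<close>, which lies in the coset of \<open>x\<close>.\<close>
  define \<Phi> :: "('a \<Rightarrow> 'a) \<Rightarrow> 'a set" where "\<Phi> \<delta> = rcoset (\<delta> e)" for \<delta>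
  have \<Phi>: "\<Phi> (\<lambda>a. a * x) = rcoset x" for x
    by (simp add: \<Phi>_def rcoset_eq_iff[OF rad])
  have add: "(\<lambda>z. z * x + z * y) = (\<lambda>z. z * (x + y))"
    and scale: "(\<lambda>z. sm c (z * x)) = (\<lambda>z. z * sm c x)"
    and comp: "(\<lambda>z. z * x) \<circ> (\<lambda>z. z * y) = (\<lambda>z. z * (x * y))" for x y c
    using comm3 by (auto simp: fun_eq_iff distrib_left sm_mult_right simp flip: mult.assoc)
  have closed: "\<forall>\<delta>\<in>CGD sm. \<forall>\<gamma>\<in>CGD sm. \<forall>c.
      (\<lambda>z. \<delta> z + \<gamma> z) \<in> CGD sm \<and> (\<lambda>z. sm c (\<delta> z)) \<in> CGD sm \<and> \<delta> \<circ> \<gamma> \<in> CGD sm"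
  proof (intro ballI allI)
    fix \<delta> \<gamma> c assume \<delta>: "\<delta> \<in> CGD sm" and \<gamma>: "\<gamma> \<in> CGD sm"
    obtain x y where "\<delta> = (\<lambda>a. a * x)" "\<gamma> = (\<lambda>a. a * y)" using form \<delta> \<gamma> by blast
    then show "(\<lambda>z. \<delta> z + \<gamma> z) \<in> CGD sm \<and> (\<lambda>z. sm c (\<delta> z)) \<in> CGD sm \<and> \<delta> \<circ> \<gamma> \<in> CGD sm"
      by (simp add: add scale comp right_mult_in_CGD)
  qed
  have bij: "bij_betw \<Phi> (CGD sm) (range rcoset)"
  proof (rule bij_betw_imageI)
    show "inj_on \<Phi> (CGD sm)"
    proof
      fix \<delta> \<gamma> assume "\<delta> \<in> CGD sm" "\<gamma> \<in> CGD sm" and eq: "\<Phi> \<delta> = \<Phi> \<gamma>"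
      then obtain x y where "\<delta> = (\<lambda>a. a * x)" "\<gamma> = (\<lambda>a. a * y)" using form by blast
      then show "\<delta> = \<gamma>" using eq by (simp add: \<Phi> rcoset_eq_iff[OF rad])
    qed
    have "\<Phi> \<delta> \<in> range rcoset" for \<delta> by (simp add: \<Phi>_def)
    moreover have "rcoset x \<in> \<Phi> ` CGD sm" for x
      using \<Phi>[of x] right_mult_in_CGD[of x] by (metis imageI)
    ultimately show "\<Phi> ` CGD sm = range rcoset" by blast
  qed
  have hom: "\<forall>\<delta>\<in>CGD sm. \<forall>\<gamma>\<in>CGD sm. \<forall>x y c. \<Phi> \<delta> = rcoset x \<longrightarrow> \<Phi> \<gamma> = rcoset y \<longrightarrow>
      \<Phi> (\<lambda>z. \<delta> z + \<gamma> z) = rcoset (x + y) \<and>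
      \<Phi> (\<lambda>z. sm c (\<delta> z)) = rcoset (sm c x) \<and>
      \<Phi> (\<delta> \<circ> \<gamma>) = rcoset (x * y)"
  proof (intro ballI allI impI)
    fix \<delta> \<gamma> x y c
    assume \<delta>: "\<delta> \<in> CGD sm" "\<Phi> \<delta> = rcoset x" and \<gamma>: "\<gamma> \<in> CGD sm" "\<Phi> \<gamma> = rcoset y"
    obtain x' y' where forms: "\<delta> = (\<lambda>a. a * x')" "\<gamma> = (\<lambda>a. a * y')"
      using form \<delta>(1) \<gamma>(1) by blast
    \<comment> \<open>Equality of cosets lets \<open>x'\<close> and \<open>y'\<close> be replaced by
      the arbitrary representatives \<open>x\<close> and \<open>y\<close>.\<close>
    then have "\<forall>a. a * x' = a * x" "\<forall>a. a * y' = a * y"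
      using \<delta>(2) \<gamma>(2) by (simp_all add: \<Phi> rcoset_eq_iff[OF rad])
    then have "\<delta> = (\<lambda>a. a * x)" "\<gamma> = (\<lambda>a. a * y)" using forms by auto
    then show "\<Phi> (\<lambda>z. \<delta> z + \<gamma> z) = rcoset (x + y) \<and>
      \<Phi> (\<lambda>z. sm c (\<delta> z)) = rcoset (sm c x) \<and> \<Phi> (\<delta> \<circ> \<gamma>) = rcoset (x * y)"
      by (simp add: add scale comp \<Phi>)
  qed
  show ?thesis
    unfolding CGD_iso_quotient_def
    by (rule conjI[OF closed], rule exI[of _ \<Phi>], rule conjI[OF bij hom])
qed

end
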